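(* Let $R\in(0,+\infty]$ and let $\alpha:\mathring D(0;R)\to\mathbb P^1(\mathbb C)$ be a non-constant meromorphic function. Assume that $\alpha(0)\neq\infty$, and let $e$ be the ramification index of $\alpha$ at $0$. For every $r\in(0,R)$, the following estimate holds: $$\mathrm{Ex}\bigl(\alpha:(\overline D(0;r),0)\to\mathbb P^1(\mathbb C)\bigr)\le2\,T_\alpha(r)-e\log r-\log\frac{|\alpha^{(e)}(0)/e!|}{1+|\alpha(0)|^2},$$ where $$T_\alpha(r):=\int_{\mathring D(0;r)}\log(r/|z|)\;\alpha^*\omega_{\mathrm{FS}} .$$
   Context: $\mathring D(0;R)$ and $\overline D(0;r)$ are the open and closed disks in $\mathbb C$ (with $\mathring D(0;+\infty)=\mathbb C$). $\omega_{\mathrm{FS}}$ is the Fubini–Study form on $\mathbb P^1(\mathbb C)$, given on $\mathbb C$ by $\frac{i}{2\pi}\frac{dz\wedge d\overline z}{(1+|z|^2)^2}$. Overflow of a non-constant map $\alpha$, holomorphic on a neighbourhood of $\overline D(0;r)$, with values in a Riemann surface $N$: put $g(z)=\log^+(r/|z|)$, let $\mu$ be the rotation invariant probability measure on the circle $|z|=r$, let $e_x$ denote the ramification index of $\alpha$ at $x$, and $\alpha_*g(y)=\sum_{x\in\alpha^{-1}(y)}e_x\,g(x)$. Then $$\mathrm{Ex}(\alpha:(\overline D(0;r),0)\to N):=\sum_{x\in\alpha^{-1}(\alpha(0)),\,x\ne0}e_x\,g(x)+\int_N\alpha_*g\;d(\alpha_*\mu),$$ where only points $x$ in the disk contribute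 and $\alpha_*\mu$ is the direct image measure. *)

theory Defs
  imports "HOL-Complex_Analysis.Complex_Analysis" "HOL-Probability.Probability"
begin

text \<open>
  The Riemann sphere $\mathbb{P}^1(\mathbb{C})$ is modelled by the type \<^typ>\<open>complex option\<close>, with
  \<^const>\<open>None\<close> the point at infinity and the topology of the one-point compactification.
\<close>

definition P1 :: "complex option topology" where
  "P1 = Alexandroff_compactification euclidean"

definition P1_borel :: "complex option measure" where
  "P1_borel = sigma (topspace P1) {U. openin P1 U}"

text \<open>
  In the library, a function that is \<^const>\<open>nicely_meromorphic_on\<close> a set takes the dummy value
  \<open>0\<close> at its poles and is continuous elsewhere. \<open>sphere_map\<close> is the associated map into
  $\mathbb{P}^1(\mathbb{C})$.
\<close>

definition sphere_map :: "(complex \<Rightarrow> complex) \<Rightarrow> complex \<Rightarrow> complex option" where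
  "sphere_map \<alpha> z = (if is_pole \<alpha> z then None else Some (\<alpha> z))"

text \<open>
  Near a pole, the chart $1/w$ of the sphere is used. Since \<open>\<alpha>\<close> takes the value \<open>0\<close> at a pole and
  \<^prop>\<open>inverse (0 :: complex) = 0\<close>, the function \<open>\<lambda>z. inverse (\<alpha> z)\<close> is holomorphic around it.
\<close>

definition ram_index :: "(complex \<Rightarrow> complex) \<Rightarrow> complex \<Rightarrow> nat" where
  "ram_index \<alpha> x =
     nat (if is_pole \<alpha> x then zorder (\<lambda>z. inverse (\<alpha> z)) x
          else zorder (\<lambda>z. \<alpha> z - \<alpha> x) x)"

text \<open>The function $\log^+(r/|z|)$; it is infinite at the origin.\<close>

definition green :: "real \<Rightarrow> complex \<Rightarrow> ennreal" where
  "green r z = (if z = 0 then \<infinity> else ennreal (max 0 (ln (r / norm z))))"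

definition green_push :: "(complex \<Rightarrow> complex) \<Rightarrow> real \<Rightarrow> complex option \<Rightarrow> ennreal" where
  "green_push \<alpha> r y =
     (\<Sum>x\<in>{x \<in> cball 0 r. sphere_map \<alpha> x = y}. of_nat (ram_index \<alpha> x) * green r x)"

text \<open>
  The rotation invariant probability measure. Its space is the circle itself, and not the whole
  plane, so that the direct image under a map depends only on that map's values on the circle.
\<close>

definition circle_measure :: "real \<Rightarrow> complex measure" where
  "circle_measure r =
     distr (uniform_measure lborel {0..2 * pi}) (restrict_space borel (sphere 0 r))
       (\<lambda>t. of_real r * cis t)"

definition overflow :: "(complex \<Rightarrow> complex) \<Rightarrow> real \<Rightarrow> ennreal" where
  "overflow \<alpha> r =
     (\<Sum>x\<in>{x \<in> cball 0 r. sphere_map \<alpha> x = sphere_map \<alpha> 0 \<and> x \<noteq> 0}.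
        of_nat (ram_index \<alpha> x) * green r x)
     + (\<integral>\<^sup>+ y. green_push \<alpha> r y \<partial>distr (circle_measure r) P1_borel (sphere_map \<alpha>))"

text \<open>
  A real 2-form on (an open subset of) the plane is a function \<open>\<eta>\<close>, where \<open>\<eta> z u v\<close> is its value
  at the point \<open>z\<close> on the tangent vectors \<open>u\<close> and \<open>v\<close>. In particular $dz\wedge d\overline z$ takes
  the value $u\overline v-v\overline u$, and the integral of \<open>\<eta>\<close> is that of its coefficient
  \<open>\<eta> z 1 \<i>\<close> against area measure.
\<close>

type_synonym two_form = "complex \<Rightarrow> complex \<Rightarrow> complex \<Rightarrow> real"

text \<open>The Fubini--Study form on the affine chart; the complex number below is real.\<close>

definition fubini_study :: two_form where
  "fubini_study w u v =
     Re (\<i> / (2 * of_real pi) * (u * cnj v - v * cnj u) / of_real ((1 + (norm w)\<^sup>2)\<^sup>2))"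

definition pullback :: "(complex \<Rightarrow> complex) \<Rightarrow> two_form \<Rightarrow> two_form" where
  "pullback f \<eta> z u v =
     \<eta> (f z) (frechet_derivative f (at z) u) (frechet_derivative f (at z) v)"

text \<open>
  The Fubini--Study form is invariant under $w\mapsto 1/w$, so it has the same expression in the
  chart at infinity.
\<close>

definition pullback_FS :: "(complex \<Rightarrow> complex) \<Rightarrow> two_form" where
  "pullback_FS \<alpha> z =
     (if is_pole \<alpha> z then pullback (\<lambda>z. inverse (\<alpha> z)) fubini_study z
      else pullback \<alpha> fubini_study z)"

definition char_fun :: "(complex \<Rightarrow> complex) \<Rightarrow> real \<Rightarrow> real" where
  "char_fun \<alpha> r = (LINT z:ball 0 r|lborel. ln (r / norm z) * pullback_FS \<alpha> z 1 \<i>)"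

end

theory Submission
  imports Defs "HOL-Real_Asymp.Real_Asymp"
begin

text \<open>
  On a disk slightly larger than $\overline D(0;r)$, write $\alpha=p/q$ with holomorphic \<open>p\<close> and
  \<open>q\<close> without common zeros, and put $U=\frac12\log(|p|^2+|q|^2)$. Then $U$ is a smooth potential
  of the pulled back Fubini--Study form, also at the poles, and Green's formula yields
  $T_\alpha(r)=\int U\,d\mu-U(0)$ (\<open>weighted_fs_integral_eq_circle_mean\<close>).

  For a point $w$, the holomorphic function $h_w(z)=q(w)p(z)-p(w)q(z)$ vanishes exactly where
  $\alpha(z)=\alpha(w)$, with the ramification index as multiplicity. Moreover
  $|h_w(z)|\le e^{U(w)+U(z)}$ by the Cauchy--Schwarz inequality, and $|h_w(0)|=|h_0(w)|$.
  Jensen's inequality (\<open>jensen_inequality\<close>) for $h_w$ with $|w|=r$ therefore gives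
  \[ \alpha_*g(\alpha(w))\le U(w)+\int U\,d\mu-\log|h_0(w)| \]
  (\<open>green_push_le\<close>), and integration over the circle bounds the second term of the overflow by
  $2\int U\,d\mu-\int\log|h_0|\,d\mu$. Jensen's inequality for $h_0(z)=z^e k(z)$, after removal
  of the zero at the origin, bounds the first term by
  $\int\log|h_0|\,d\mu-e\log r-\log|k(0)|$. In the sum, the integral of $\log|h_0|$ cancels. The
  estimate follows from $\int U\,d\mu=T_\alpha(r)+U(0)$, because
  $2U(0)=2\log|q(0)|+\log(1+|\alpha(0)|^2)$ and $|k(0)|=|q(0)|^2|\alpha^{(e)}(0)/e!|$.

  Jensen's formula is stated as an inequality because $h_w$ always vanishes at the point $w$ of the
  circle: this direction follows from Fatou's lemma also when there are zeros on the circle.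
\<close>

section \<open>Integration in polar coordinates\<close>

text \<open>
  The change of variables theorem is about $\mathbb{R}^2$ as a type of vectors, Tonelli's theorem
  about iterated integrals; this is the bridge between the two.
\<close>

lemma nn_integral_vec2:
  fixes f :: "real^2 \<Rightarrow> ennreal"
  assumes [measurable]: "f \<in> borel_measurable borel"
  shows "(\<integral>\<^sup>+x. f x \<partial>lborel) = (\<integral>\<^sup>+s. \<integral>\<^sup>+t. f (vector [s, t]) \<partial>lborel \<partial>lborel)"
proof -
  define T :: "real \<times> real \<Rightarrow> real^2" where "T = (\<lambda>x. \<chi> i. if i = 1 then fst x else snd x)"
  have T_eq: "T (s, t) = vector [s, t]" for s t
    by (simp add: T_def vec_eq_iff forall_2)
  have "continuous_on UNIV T"
    unfolding T_def
  proof (rule continuous_on_vec_lambda)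
    show "continuous_on UNIV (\<lambda>x :: real \<times> real. if i = 1 then fst x else snd x)" for i :: 2
      by (cases "i = 1") (auto intro!: continuous_intros)
  qed
  hence [measurable]: "T \<in> borel_measurable borel"
    by (rule borel_measurable_continuous_onI)
  have "lborel = distr (lborel :: (real \<times> real) measure) borel T"
  proof (rule lborel_eqI)
    fix l u :: "real^2" assume le: "\<And>b. b \<in> Basis \<Longrightarrow> l \<bullet> b \<le> u \<bullet> b"
    have le': "l $ i \<le> u $ i" for i
      using le[of "axis i 1"] by (simp add: inner_axis axis_in_Basis_iff)
    have "T -` box l u = box (l $ 1, l $ 2) (u $ 1, u $ 2)"
      by (auto simp: T_def mem_box_cart forall_2 mem_box Basis_prod_def)
    hence "emeasure (distr lborel borel T) (box l u) = emeasure lborel (box (l $ 1, l $ 2) (u $ 1, u $ 2))"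
      by (simp add: emeasure_distr)
    also have "\<dots> = (\<Prod>b\<in>Basis. ((u $ 1, u $ 2) - (l $ 1, l $ 2)) \<bullet> b)"
      using le' by (subst emeasure_lborel_box) (auto simp: Basis_prod_def)
    also have "(\<Prod>b\<in>Basis. ((u $ 1, u $ 2) - (l $ 1, l $ 2)) \<bullet> b) = (\<Prod>b\<in>Basis. (u - l) \<bullet> b)"
    proof -
      have "(\<Prod>b\<in>Basis. (u - l) \<bullet> b) = (\<Prod>i\<in>UNIV. (u - l) $ i)"
        by (subst Basis_vec_def) (simp add: prod.UNION_disjoint inner_axis axis_eq_axis)
      moreover have "(Basis :: (real \<times> real) set) = {(1, 0), (0, 1)}"
        by (auto simp: Basis_prod_def)
      moreover have "(\<Prod>b\<in>{(1, 0), (0, 1)}. ((u $ 1, u $ 2) - (l $ 1, l $ 2)) \<bullet> b)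
          = (u $ 1 - l $ 1) * (u $ 2 - l $ 2)"
        by simp
      ultimately show ?thesis by (simp only: UNIV_2) simp
    qed
    finally show "emeasure (distr lborel borel T) (box l u) = (\<Prod>b\<in>Basis. (u - l) \<bullet> b)" .
  qed auto
  hence "(\<integral>\<^sup>+x. f x \<partial>lborel) = (\<integral>\<^sup>+x. f x \<partial>distr (lborel :: (real \<times> real) measure) borel T)"
    by simp
  also have "\<dots> = (\<integral>\<^sup>+x. f (T x) \<partial>(lborel \<Otimes>\<^sub>M lborel))"
    by (subst nn_integral_distr) (auto simp: lborel_prod)
  also have "\<dots> = (\<integral>\<^sup>+s. \<integral>\<^sup>+t. f (T (s, t)) \<partial>lborel \<partial>lborel)"
    by (rule lborel.nn_integral_fst [symmetric]) (simp add: lborel_prod)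
  finally show ?thesis by (simp add: T_eq)
qed

text \<open>
  The polar map \<open>P\<close> sends the strip \<open>S\<close> bijectively onto the plane without the closed positive
  half axis, which is a null set, and its Jacobian determinant is the radius.
\<close>

lemma polar_coordinates_vec2:
  fixes P :: "real^2 \<Rightarrow> real^2"
  defines "P \<equiv> (\<lambda>x. (x$1 * cos (x$2)) *\<^sub>R axis 1 1 + (x$1 * sin (x$2)) *\<^sub>R axis 2 1)"
  defines "S \<equiv> {x :: real^2. 0 < x$1 \<and> 0 < x$2 \<and> x$2 < 2 * pi}"
  assumes A: "A \<in> sets borel" "A \<in> lmeasurable"
  shows "(\<integral>\<^sup>+x. indicator {x \<in> S. P x \<in> A} x * ennreal (x$1) \<partial>lborel) = emeasure lborel A"
proof -
  have [simp]: "P x $ 1 = x$1 * cos (x$2)" "P x $ 2 = x$1 * sin (x$2)" for x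
    by (simp_all add: P_def axis_def)
  define B where "B = {x \<in> S. P x \<in> A}"
  have der: "(P has_derivative (\<lambda>h. (h$1 * cos (x$2) - x$1 * sin (x$2) * h$2) *\<^sub>R axis 1 1
      + (h$1 * sin (x$2) + x$1 * cos (x$2) * h$2) *\<^sub>R axis 2 1)) (at x within B)" for x
    unfolding P_def
    by (auto intro!: derivative_eq_intros bounded_linear.has_derivative[OF bounded_linear_vec_nth]
             simp: algebra_simps)
  have det: "det (matrix (\<lambda>h :: real^2. (h$1 * cos (x$2) - x$1 * sin (x$2) * h$2) *\<^sub>R axis 1 1
      + (h$1 * sin (x$2) + x$1 * cos (x$2) * h$2) *\<^sub>R axis 2 (1::real)) :: real^2^2) = x$1" for x :: "real^2"
  proof -
    have "x$1 * (cos (x$2) * cos (x$2)) + x$1 * (sin (x$2) * sin (x$2)) = x$1"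
      by (metis distrib_left mult.right_neutral sin_cos_squared_add3)
    thus ?thesis by (simp add: det_2 matrix_def axis_def algebra_simps)
  qed
  have arg: "Complex (P x $ 1) (P x $ 2) = of_real (x$1) * exp (\<i> * of_real (x$2))" for x
    by (simp add: complex_eq_iff cis_conv_exp [symmetric])
  have inj: "inj_on P B"
  proof (rule inj_onI)
    fix x y assume xy: "x \<in> B" "y \<in> B" "P x = P y"
    have pos: "0 < x$1" "0 < x$2" "x$2 < 2 * pi" "0 < y$1" "0 < y$2" "y$2 < 2 * pi"
      using xy by (auto simp: B_def S_def)
    have eq: "of_real (x$1) * exp (\<i> * of_real (x$2)) = of_real (y$1) * exp (\<i> * of_real (y$2))"
      using arg[of x] arg[of y] xy(3) by simp
    have "x$2 = y$2"
      using Arg2pi_unique[OF eq] Arg2pi_unique[OF refl, of "y$1" "y$2"] pos by simp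
    moreover have "x$1 = y$1"
      using arg_cong[OF eq, of norm] pos by (simp add: norm_mult)
    ultimately show "x = y" by (simp add: vec_eq_iff forall_2)
  qed
  have image: "P ` B = A - {y. y$2 = 0 \<and> 0 \<le> y$1}"
  proof (intro equalityI subsetI)
    fix y assume "y \<in> P ` B"
    then obtain x where x: "x \<in> B" "y = P x" by auto
    have pos: "0 < x$1" "0 < x$2" "x$2 < 2 * pi" using x by (auto simp: B_def S_def)
    have "Arg2pi (Complex (P x $ 1) (P x $ 2)) = x$2"
      using Arg2pi_unique[OF arg[of x, symmetric]] pos by simp
    hence "Complex (P x $ 1) (P x $ 2) \<notin> \<real> \<or> P x $ 1 < 0"
      using pos Arg2pi_eq_0[of "Complex (P x $ 1) (P x $ 2)"] by force
    thus "y \<in> A - {y. y$2 = 0 \<and> 0 \<le> y$1}"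
      using x by (auto simp: complex_is_Real_iff B_def)
  next
    fix y :: "real^2" assume y: "y \<in> A - {y. y$2 = 0 \<and> 0 \<le> y$1}"
    define z where "z = Complex (y$1) (y$2)"
    define x :: "real^2" where "x = vector [cmod z, Arg2pi z]"
    have "Arg2pi z \<noteq> 0" unfolding Arg2pi_eq_0 using y by (auto simp: z_def complex_is_Real_iff)
    moreover have "z \<noteq> 0" using y by (auto simp: z_def complex_eq_iff)
    ultimately have "x \<in> S" using Arg2pi[of z] by (auto simp: S_def x_def less_le)
    moreover have "P x = y"
      using cos_Arg2pi[of z] sin_Arg2pi[of z] by (auto simp: vec_eq_iff forall_2 x_def z_def)
    ultimately show "y \<in> P ` B" using y by (force simp: B_def)
  qed
  have null: "negligible ({y. y$2 = 0 \<and> 0 \<le> y$1} :: (real^2) set)"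
    by (rule negligible_subset[OF negligible_standard_hyperplane_cart[of 2]]) auto
  hence null': "{y. y$2 = 0 \<and> 0 \<le> y$1} \<in> null_sets (lebesgue :: (real^2) measure)"
    by (simp add: negligible_iff_null_sets)
  have "continuous_on UNIV P"
    unfolding P_def by (intro continuous_intros)
  hence Pm: "P \<in> borel_measurable borel"
    by (rule borel_measurable_continuous_onI)
  have B: "B \<in> sets borel"
  proof -
    have "B = {x. 0 < x$1} \<inter> {x. 0 < x$2} \<inter> {x. x$2 < 2 * pi} \<inter> (P -` A \<inter> space borel)"
      by (auto simp: B_def S_def)
    also have "\<dots> \<in> sets borel"
    proof (rule sets.Int)
      show "P -` A \<inter> space borel \<in> sets borel"
        using measurable_sets[OF Pm A(1)] by simp
      show "{x :: real^2. 0 < x$1} \<inter> {x. 0 < x$2} \<inter> {x. x$2 < 2 * pi} \<in> sets borel"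
        by (intro sets.Int borel_open open_Collect_less continuous_intros)
    qed
    finally show ?thesis .
  qed
  hence B': "B \<in> sets lebesgue"
    using sets_completionI_sets[of B lborel] by simp
  have "P ` B \<in> lmeasurable \<and> measure lebesgue (P ` B) = measure lebesgue A"
    unfolding image
    using fmeasurable_Diff[OF A(2) null_setsD2[OF null']] measure_Diff_null_set[OF fmeasurableD[OF A(2)] null']
    by blast
  hence "((\<lambda>x. \<bar>x$1\<bar>) has_integral measure lebesgue A) B"
    unfolding has_measure_differentiable_image[OF B' der inj] det .
  hence "((\<lambda>x. x$1) has_integral measure lebesgue A) B"
    by (rule has_integral_eq[rotated]) (auto simp: B_def S_def)
  from nn_integral_has_integral_lebesgue[OF _ this]
  have "(\<integral>\<^sup>+x. ennreal (indicator B x * x$1) \<partial>lborel) = ennreal (measure lebesgue A)"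
    by (auto simp: B_def S_def)
  also have "\<dots> = emeasure lebesgue A"
    by (rule emeasure_eq_measure2[OF A(2), symmetric])
  also have "\<dots> = emeasure lborel A"
    using A(1) by simp
  finally show ?thesis
    unfolding B_def by (simp add: ennreal_mult' ennreal_indicator)
qed

text \<open>
  The right-hand side is the integral against the direct image of \<open>\<rho> d\<rho> dt\<close> under the polar map.
  A Borel measure is determined by its values on boxes, and \<open>polar_coordinates_vec2\<close> computes
  these.
\<close>

lemma nn_integral_polar_coordinates:
  fixes f :: "complex \<Rightarrow> ennreal"
  assumes f [measurable]: "f \<in> borel_measurable borel"
  shows "(\<integral>\<^sup>+z. f z \<partial>lborel) = (\<integral>\<^sup>+\<rho>\<in>{0<..}. (\<integral>\<^sup>+t\<in>{0<..<2 * pi}.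
           ennreal \<rho> * f (of_real \<rho> * cis t) \<partial>lborel) \<partial>lborel)"
proof -
  define S where "S = {x :: real^2. 0 < x$1 \<and> 0 < x$2 \<and> x$2 < 2 * pi}"
  define P :: "real^2 \<Rightarrow> real^2"
    where "P = (\<lambda>x. (x$1 * cos (x$2)) *\<^sub>R axis 1 1 + (x$1 * sin (x$2)) *\<^sub>R axis 2 1)"
  define Q where "Q = (\<lambda>x :: real^2. of_real (x$1) * cis (x$2))"
  have [measurable]: "Q \<in> borel_measurable borel"
    unfolding Q_def by (intro borel_measurable_continuous_onI continuous_intros)
  have S [measurable]: "S \<in> sets borel"
  proof -
    have "S = {x. 0 < x$1} \<inter> {x. 0 < x$2} \<inter> {x. x$2 < 2 * pi}"
      by (auto simp: S_def)
    also have "\<dots> \<in> sets borel"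
      by (intro sets.Int borel_open open_Collect_less continuous_intros)
    finally show ?thesis .
  qed
  have [measurable]: "(\<lambda>x :: real^2. x$i) \<in> borel_measurable borel" for i
    by (intro borel_measurable_continuous_onI continuous_intros)
  define D where "D = density lborel (\<lambda>x. indicator S x * ennreal (x$1))"
  have "lborel = distr D borel Q"
  proof (rule lborel_eqI)
    fix l u :: complex assume le: "\<And>b. b \<in> Basis \<Longrightarrow> l \<bullet> b \<le> u \<bullet> b"
    have le': "Re l \<le> Re u" "Im l \<le> Im u"
      using le[of 1] le[of \<i>] by (auto simp: Basis_complex_def)
    define A :: "(real^2) set" where "A = box (vector [Re l, Im l]) (vector [Re u, Im u])"
    have "emeasure (distr D borel Q) (box l u) = emeasure D (Q -` box l u)"
      by (subst emeasure_distr) (auto simp: D_def)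
    also have "\<dots> = (\<integral>\<^sup>+x. (indicator S x * ennreal (x$1)) * indicator (Q -` box l u) x \<partial>lborel)"
      unfolding D_def by (rule emeasure_density) (auto intro: measurable_sets_borel[OF \<open>Q \<in> borel_measurable borel\<close>])
    also have "\<dots> = (\<integral>\<^sup>+x. indicator {x \<in> S. P x \<in> A} x * ennreal (x$1) \<partial>lborel)"
      by (intro nn_integral_cong)
         (auto simp: indicator_def A_def P_def Q_def mem_box_cart forall_2 mem_box Basis_complex_def axis_def)
    also have "\<dots> = emeasure lborel A"
      unfolding S_def P_def by (rule polar_coordinates_vec2) (auto simp: A_def)
    also have "\<dots> = ennreal ((Re u - Re l) * (Im u - Im l))"
    proof -
      have "emeasure lborel A = ennreal (measure lborel A)"
        by (simp add: A_def emeasure_eq_measure2)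
      also have "measure lborel A = (\<Prod>i\<in>UNIV. (vector [Re u, Im u] :: real^2) $ i - (vector [Re l, Im l] :: real^2) $ i)"
        unfolding A_def using le' content_cbox_cart[of "vector [Re l, Im l] :: real^2" "vector [Re u, Im u]"]
        by (simp add: measure_lborel_box_eq measure_lborel_cbox_eq  interval_ne_empty_cart forall_2)
      finally show ?thesis by (simp add: UNIV_2)
    qed
    also have "\<dots> = (\<Prod>b\<in>Basis. (u - l) \<bullet> b)"
      by (simp add: Basis_complex_def)
    finally show "emeasure (distr D borel Q) (box l u) = (\<Prod>b\<in>Basis. (u - l) \<bullet> b)" .
  qed simp
  hence "(\<integral>\<^sup>+z. f z \<partial>lborel) = (\<integral>\<^sup>+z. f z \<partial>distr D borel Q)"
    by simp
  also have "\<dots> = (\<integral>\<^sup>+x. f (Q x) \<partial>D)"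
    by (rule nn_integral_distr) (auto simp: D_def)
  also have "\<dots> = (\<integral>\<^sup>+x. (indicator S x * ennreal (x$1)) * f (Q x) \<partial>lborel)"
    unfolding D_def by (rule nn_integral_density) auto
  also have "\<dots> = (\<integral>\<^sup>+s. \<integral>\<^sup>+t. (indicator S (vector [s, t] :: real^2) * ennreal s) * f (of_real s * cis t) \<partial>lborel \<partial>lborel)"
  proof -
    have "(\<lambda>x. (indicator S x * ennreal (x$1)) * f (Q x)) \<in> borel_measurable borel"
      by measurable
    from nn_integral_vec2[OF this] show ?thesis by (simp add: Q_def)
  qed
  also have "\<dots> = (\<integral>\<^sup>+s\<in>{0<..}. (\<integral>\<^sup>+t\<in>{0<..<2 * pi}. ennreal s * f (of_real s * cis t) \<partial>lborel) \<partial>lborel)"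
  proof (rule nn_integral_cong)
    fix s :: real
    have "(\<integral>\<^sup>+t. (indicator S (vector [s, t] :: real^2) * ennreal s) * f (of_real s * cis t) \<partial>lborel)
      = (\<integral>\<^sup>+t. indicator {0<..} s * (ennreal s * f (of_real s * cis t) * indicator {0<..<2 * pi} t) \<partial>lborel)"
      by (intro nn_integral_cong) (auto simp: S_def indicator_def)
    also have "\<dots> = (\<integral>\<^sup>+t\<in>{0<..<2 * pi}. ennreal s * f (of_real s * cis t) \<partial>lborel) * indicator {0<..} s"
      by (simp add: indicator_def)
    finally show "(\<integral>\<^sup>+t. (indicator S (vector [s, t] :: real^2) * ennreal s) * f (of_real s * cis t) \<partial>lborel) = \<dots>" .
  qed
  finally show ?thesis .
qed

section \<open>Jensen's inequality\<close>

text \<open>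
  Means over the circle of radius \<open>r\<close> are written as integrals over the angle, so that circles of
  different radii share one probability space.
\<close>

abbreviation angle_measure :: "real measure" where
  "angle_measure \<equiv> uniform_measure lborel {0..2 * pi}"

lemma prob_space_angle_measure: "prob_space angle_measure"
  by (rule prob_space_uniform_measure) auto

interpretation angle: prob_space angle_measure
  by (rule prob_space_angle_measure)

lemma AE_angle_range: "AE t in angle_measure. t \<in> {0..2 * pi}"
  by (subst AE_uniform_measure) auto

text \<open>
  The parametrisation of the circle takes each value at most twice, namely at the argument and, for
  the value \<open>r\<close>, also at $2\pi$.
\<close>

lemma AE_angle_finite:
  assumes "finite A" "r > 0"
  shows "AE t in angle_measure. of_real r * cis t \<notin> A"
proof -
  have "finite {t \<in> {0..2 * pi}. of_real r * cis t = z}" for z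
  proof -
    have "{t \<in> {0..2 * pi}. of_real r * cis t = z} \<subseteq> {Arg2pi z, 2 * pi}"
      using assms by (auto intro!: Arg2pi_unique[symmetric] simp: cis_conv_exp)
    thus ?thesis by (rule finite_subset) auto
  qed
  hence fin: "finite (\<Union>z\<in>A. {t \<in> {0..2 * pi}. of_real r * cis t = z})"
    using assms by blast
  have "AE t in lborel. t \<notin> (\<Union>z\<in>A. {t \<in> {0..2 * pi}. of_real r * cis t = z})"
    using fin by (intro AE_not_in) (auto intro!: finite_imp_null_set_lborel)
  hence "AE t in angle_measure. t \<notin> (\<Union>z\<in>A. {t \<in> {0..2 * pi}. of_real r * cis t = z})"
    by (subst AE_uniform_measure) auto
  with AE_angle_range show ?thesis
    by eventually_elim auto
qed

lemma
  fixes f :: "real \<Rightarrow> real"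
  assumes cont: "continuous_on UNIV f"
  shows integrable_angle_continuous: "integrable angle_measure f"
    and integral_angle_continuous: "(LINT t|angle_measure. f t) = integral {0..2 * pi} f / (2 * pi)"
proof -
  have eq: "angle_measure = density lborel (\<lambda>t. ennreal (indicator {0..2 * pi} t / (2 * pi)))"
    unfolding uniform_measure_def
    by (intro density_cong) (auto simp: divide_ennreal[symmetric] ennreal_indicator)
  have int: "set_integrable lborel {0..2 * pi} f"
    using continuous_on_subset[OF cont] by (intro borel_integrable_atLeastAtMost') auto
  have [measurable]: "f \<in> borel_measurable borel"
    using cont by (rule borel_measurable_continuous_onI)
  have scale: "(indicator {0..2 * pi} t / (2 * pi)) *\<^sub>R f t = (indicator {0..2 * pi} t *\<^sub>R f t) / (2 * pi)" for t
    by simp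
  show "integrable angle_measure f"
    unfolding eq using int
    by (subst integrable_density) (auto simp: scale set_integrable_def simp del: real_scaleR_def)
  have "(LINT t|angle_measure. f t) = (LINT t:{0..2 * pi}|lborel. f t) / (2 * pi)"
    unfolding eq set_lebesgue_integral_def
    by (subst integral_density) (auto simp: scale simp del: real_scaleR_def)
  also have "(LINT t:{0..2 * pi}|lborel. f t) = integral {0..2 * pi} f"
    using int by (rule set_borel_integral_eq_integral)
  finally show "(LINT t|angle_measure. f t) = integral {0..2 * pi} f / (2 * pi)" .
qed

lemma continuous_on_circle:
  assumes "continuous_on A f" "sphere 0 r \<subseteq> A" "r \<ge> 0"
  shows "continuous_on UNIV (\<lambda>t. f (of_real r * cis t))"
  by (rule continuous_on_compose2[OF assms(1)])
     (use assms in \<open>auto intro!: continuous_intros simp: norm_mult\<close>)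

text \<open>
  On a disk, \<open>g\<close> has a holomorphic logarithm \<open>l\<close>; then $\log|g|$ is the real part of \<open>l\<close>, and the
  mean value property is Cauchy's integral formula at the centre.
\<close>

lemma circle_mean_ln_norm_nonvanishing:
  assumes g: "g holomorphic_on ball 0 R" "\<And>z. z \<in> ball 0 R \<Longrightarrow> g z \<noteq> 0" and r: "0 < r" "r < R"
  shows "integrable angle_measure (\<lambda>t. ln (norm (g (of_real r * cis t))))"
    and "(LINT t|angle_measure. ln (norm (g (of_real r * cis t)))) = ln (norm (g 0))"
proof -
  have "g holomorphic_on ball 0 R" by fact
  then obtain l where l: "l holomorphic_on ball 0 R" "\<And>z. z \<in> ball 0 R \<Longrightarrow> g z = exp (l z)"
    using contractible_imp_holomorphic_log[of g "ball 0 R"] g(2) convex_imp_contractible convex_ball by metis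
  have ln_eq: "ln (norm (g z)) = Re (l z)" if "z \<in> ball 0 R" for z
    using l(2)[OF that] by simp
  have in_ball: "of_real r * cis t \<in> ball 0 R" for t
    using r by (simp add: norm_mult)
  have eq: "(\<lambda>t. ln (norm (g (of_real r * cis t)))) = (\<lambda>t. Re (l (of_real r * cis t)))"
    using ln_eq[OF in_ball] by simp
  have "continuous_on (ball 0 R) l"
    using l(1) by (rule holomorphic_on_imp_continuous_on)
  hence "continuous_on UNIV (\<lambda>t. l (of_real r * cis t))"
    using r by (intro continuous_on_circle) auto
  hence cont: "continuous_on UNIV (\<lambda>t. Re (l (of_real r * cis t)))"
    by (intro continuous_intros)
  show "integrable angle_measure (\<lambda>t. ln (norm (g (of_real r * cis t))))"
    unfolding eq using cont by (rule integrable_angle_continuous)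
  have "l holomorphic_on cball 0 r"
    using l(1) r by (elim holomorphic_on_subset) auto
  hence "((\<lambda>u. l u / (u - 0)) has_contour_integral (2 * of_real pi * \<i> * l 0)) (circlepath 0 r)"
    using r by (intro Cauchy_integral_circlepath_simple) auto
  hence "((\<lambda>t. l (of_real r * cis t) / (of_real r * cis t) * r * \<i> * cis t) has_integral (2 * of_real pi * \<i> * l 0)) {0..2 * pi}"
    unfolding circlepath_def by (subst (asm) has_contour_integral_part_circlepath_iff) auto
  hence "((\<lambda>t. -\<i> * (l (of_real r * cis t) / (of_real r * cis t) * r * \<i> * cis t)) has_integral (-\<i> * (2 * of_real pi * \<i> * l 0))) {0..2 * pi}"
    by (rule has_integral_mult_right)
  also have "(\<lambda>t. -\<i> * (l (of_real r * cis t) / (of_real r * cis t) * r * \<i> * cis t)) = (\<lambda>t. l (of_real r * cis t))"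
    using r by (auto simp: fun_eq_iff field_simps)
  also have "-\<i> * (2 * of_real pi * \<i> * l 0) = 2 * of_real pi * l 0"
    by (simp add: field_simps)
  finally have "((\<lambda>t. Re (l (of_real r * cis t))) has_integral Re (2 * of_real pi * l 0)) {0..2 * pi}"
    by (rule has_integral_Re)
  hence "integral {0..2 * pi} (\<lambda>t. Re (l (of_real r * cis t))) = 2 * pi * Re (l 0)"
    by (simp add: integral_unique)
  thus "(LINT t|angle_measure. ln (norm (g (of_real r * cis t)))) = ln (norm (g 0))"
    unfolding eq integral_angle_continuous[OF cont] using ln_eq[of 0] r by simp
qed

text \<open>
  When \<open>a\<close> lies on the circle, $\log|z-a|$ is unbounded below there. On smaller concentric circles
  it has mean $\log r$, and $\log 2r-\log|z-a|$ is nonnegative. Fatou's lemma for radii increasing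
  to \<open>r\<close> gives the integrability and the lower bound together.
\<close>

lemma circle_mean_ln_norm_diff_on_circle:
  assumes r: "0 < r" and a: "norm a = r"
  shows "integrable angle_measure (\<lambda>t. ln (norm (of_real r * cis t - a)))"
    and "ln r \<le> (LINT t|angle_measure. ln (norm (of_real r * cis t - a)))"
proof -
  define \<rho> where "\<rho> n = r * (1 - 1 / (real n + 2))" for n :: nat
  have \<rho>: "0 < \<rho> n" "\<rho> n < r" for n
    using r by (auto simp: \<rho>_def field_simps intro!: add_pos_nonneg)
  have \<rho>_lim: "\<rho> \<longlonglongrightarrow> r"
  proof -
    have "(\<lambda>n. r * (1 - 1 / (real n + 2))) \<longlonglongrightarrow> r * (1 - 0)"
      by (intro tendsto_intros) real_asymp
    thus ?thesis by (simp add: \<rho>_def [abs_def])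
  qed
  define C where "C = ln (2 * r)"
  define f where "f s t = C - ln (norm (of_real s * cis t - a))" for s t
  have [measurable]: "cis \<in> borel_measurable borel"
    by (intro borel_measurable_continuous_onI continuous_intros)
  have [measurable]: "f s \<in> borel_measurable borel" for s
    unfolding f_def by measurable
  have f_nonneg: "0 \<le> f s t" if "0 \<le> s" "s \<le> r" "of_real s * cis t \<noteq> a" for s t
  proof -
    have "norm (of_real s * cis t - a) \<le> s + r"
      using norm_triangle_ineq4[of "of_real s * cis t" a] that a by (simp add: norm_mult)
    thus ?thesis using that r by (simp add: f_def C_def)
  qed
  have mean: "integrable angle_measure (f (\<rho> n))" "(LINT t|angle_measure. f (\<rho> n) t) = C - ln r" for n
  proof -
    have *: "(\<lambda>z. z - a) holomorphic_on ball 0 r" "\<And>z. z \<in> ball 0 r \<Longrightarrow> z - a \<noteq> 0"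
      using a by (auto intro!: holomorphic_intros)
    note mean = circle_mean_ln_norm_nonvanishing[OF * \<rho>]
    show "integrable angle_measure (f (\<rho> n))" "(LINT t|angle_measure. f (\<rho> n) t) = C - ln r"
      unfolding f_def using mean a by (auto simp: angle.prob_space)
  qed
  have ne: "AE t in angle_measure. of_real r * cis t \<noteq> a"
    using AE_angle_finite[of "{a}" r] r by simp
  have "(\<integral>\<^sup>+t. ennreal (f r t) \<partial>angle_measure) \<le> (\<integral>\<^sup>+t. liminf (\<lambda>n. ennreal (f (\<rho> n) t)) \<partial>angle_measure)"
  proof (rule nn_integral_mono_AE)
    show "AE t in angle_measure. ennreal (f r t) \<le> liminf (\<lambda>n. ennreal (f (\<rho> n) t))"
      using ne
    proof eventually_elim
      case (elim t)
      have "(\<lambda>n. f (\<rho> n) t) \<longlonglongrightarrow> f r t"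
        unfolding f_def using elim by (intro tendsto_intros \<rho>_lim) auto
      hence "(\<lambda>n. ennreal (f (\<rho> n) t)) \<longlonglongrightarrow> ennreal (f r t)"
        by (rule tendsto_ennrealI)
      thus ?case by (simp add: lim_imp_Liminf)
    qed
  qed
  also have "\<dots> \<le> liminf (\<lambda>n. \<integral>\<^sup>+t. ennreal (f (\<rho> n) t) \<partial>angle_measure)"
    by (rule nn_integral_liminf) measurable
  also have "\<dots> = liminf (\<lambda>n. ennreal (C - ln r))"
  proof -
    have "(\<integral>\<^sup>+t. ennreal (f (\<rho> n) t) \<partial>angle_measure) = ennreal (C - ln r)" for n
    proof (subst nn_integral_eq_integral)
      have "of_real (\<rho> n) * cis t \<noteq> a" for t
        using \<rho>[of n] a by (auto simp: norm_mult)
      thus "AE t in angle_measure. 0 \<le> f (\<rho> n) t"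
        using \<rho>[of n] by (intro AE_I2 f_nonneg) auto
    qed (use mean in auto)
    thus ?thesis by simp
  qed
  also have "\<dots> = ennreal (C - ln r)"
    by (simp add: Liminf_const)
  finally have le: "(\<integral>\<^sup>+t. ennreal (f r t) \<partial>angle_measure) \<le> ennreal (C - ln r)" .
  have nonneg: "AE t in angle_measure. 0 \<le> f r t"
    using ne by eventually_elim (use r in \<open>auto intro!: f_nonneg\<close>)
  have int: "integrable angle_measure (f r)"
    using le by (intro integrableI_nonneg nonneg) (auto intro: le_less_trans)
  have "integrable angle_measure (\<lambda>t. C - f r t)"
    using int by (intro Bochner_Integration.integrable_diff) auto
  thus int': "integrable angle_measure (\<lambda>t. ln (norm (of_real r * cis t - a)))"
    by (simp add: f_def)
  have "ennreal (LINT t|angle_measure. f r t) \<le> ennreal (C - ln r)"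
    using le nn_integral_eq_integral[OF int nonneg] by simp
  moreover have "0 \<le> C - ln r" using r by (simp add: C_def)
  ultimately have "(LINT t|angle_measure. f r t) \<le> C - ln r"
    by (simp add: ennreal_le_iff)
  moreover have "(LINT t|angle_measure. f r t) = C - (LINT t|angle_measure. ln (norm (of_real r * cis t - a)))"
    unfolding f_def using int' by (simp add: angle.prob_space)
  ultimately show "ln r \<le> (LINT t|angle_measure. ln (norm (of_real r * cis t - a)))"
    by simp
qed

lemma circle_mean_ln_norm_diff:
  assumes r: "0 < r"
  shows "integrable angle_measure (\<lambda>t. ln (norm (of_real r * cis t - a)))"
    and "ln (max r (norm a)) \<le> (LINT t|angle_measure. ln (norm (of_real r * cis t - a)))"
proof -
  have "integrable angle_measure (\<lambda>t. ln (norm (of_real r * cis t - a)))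
    \<and> ln (max r (norm a)) \<le> (LINT t|angle_measure. ln (norm (of_real r * cis t - a)))"
  proof (cases "norm a" r rule: linorder_cases)
    case equal
    thus ?thesis using circle_mean_ln_norm_diff_on_circle[OF r, of a] by simp
  next
    case greater
    have "(\<lambda>z. z - a) holomorphic_on ball 0 (norm a)" "\<And>z. z \<in> ball 0 (norm a) \<Longrightarrow> z - a \<noteq> 0"
      by (auto intro!: holomorphic_intros)
    from circle_mean_ln_norm_nonvanishing[OF this r greater] show ?thesis
      using greater by auto
  next
    case less
    \<comment> \<open>On the circle, \<open>z - a\<close> and its reflection \<open>g\<close> have the same modulus, and \<open>g\<close> vanishes only at
      the mirror image $r^2/\overline a$ of \<open>a\<close>, outside the closed disk. The radius \<open>R\<close> reaches
      up to this point. For \<open>a = 0\<close> the reflection is constant, and any radius above \<open>r\<close> will do.\<close>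
    define R where "R = (if a = 0 then 2 * r else r\<^sup>2 / norm a)"
    have R: "r < R"
      using less r by (auto simp: R_def field_simps power2_eq_square)
    define g where "g z = (of_real (r\<^sup>2) - cnj a * z) / of_real r" for z
    have g0: "g z \<noteq> 0" if "z \<in> ball 0 R" for z
    proof
      assume "g z = 0"
      hence eq: "of_real (r\<^sup>2) = cnj a * z" using r by (simp add: g_def)
      have "a \<noteq> 0" using eq r by auto
      moreover have "r\<^sup>2 = norm a * norm z" using arg_cong[OF eq, of norm] by (simp add: norm_mult norm_power)
      ultimately show False using that by (auto simp: R_def field_simps)
    qed
    have "g holomorphic_on ball 0 R"
      unfolding g_def using r by (auto intro!: holomorphic_intros)
    note mean = circle_mean_ln_norm_nonvanishing[OF this g0 r R]
    have "norm (g (of_real r * cis t)) = norm (of_real r * cis t - a)" for t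
    proof -
      have "g (of_real r * cis t) = cis t * cnj (of_real r * cis t - a)"
        using r by (simp add: g_def power2_eq_square field_simps cis_cnj cis_mult)
      thus ?thesis by (simp add: norm_mult del: complex_cnj_diff complex_cnj_mult)
    qed
    moreover have "norm (g 0) = r"
      using r by (simp add: g_def power2_eq_square)
    ultimately show ?thesis using mean less by simp
  qed
  thus "integrable angle_measure (\<lambda>t. ln (norm (of_real r * cis t - a)))"
    and "ln (max r (norm a)) \<le> (LINT t|angle_measure. ln (norm (of_real r * cis t - a)))"
    by auto
qed


lemma zorder_monomial:
  "zorder (\<lambda>w. (w - a) ^ n) z = (if z = a then int n else 0)"
proof (cases "z = a")
  case True
  thus ?thesis
    by (auto intro!: zorder_eqI[where S = UNIV and g = "\<lambda>_. 1"])
qed (auto intro!: zorder_eq_0I analytic_intros)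

lemma finite_zeros_in_ball:
  assumes h: "h holomorphic_on ball 0 R" "h 0 \<noteq> 0" and "r < R" "0 < r"
  shows "finite {a \<in> cball 0 r. h a = 0}"
proof (cases "h constant_on ball 0 R")
  case True
  then obtain c where c: "\<And>z. z \<in> ball 0 R \<Longrightarrow> h z = c" by (auto simp: constant_on_def)
  hence "{a \<in> cball 0 r. h a = 0} = {}" using assms c[of 0] by force
  thus ?thesis by (metis finite.emptyI)
next
  case False
  thus ?thesis using assms by (intro holomorphic_compact_finite_zeros[of h "ball 0 R"]) auto
qed

lemma holomorphic_eventually_nonzero:
  fixes h :: "complex \<Rightarrow> complex"
  assumes "h holomorphic_on ball 0 R" "h 0 \<noteq> 0" "z \<in> ball 0 R"
  shows "eventually (\<lambda>w. h w \<noteq> 0) (at z)"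
proof -
  have "0 < R" using assms(3) by (auto intro: le_less_trans[OF norm_ge_zero])
  hence "eventually (\<lambda>w. h w \<noteq> 0 \<and> w \<in> ball 0 R) (at z)"
    using assms by (intro non_zero_neighbour_alt[where \<beta> = 0]) auto
  thus ?thesis by eventually_elim auto
qed

text \<open>
  Dividing \<open>h\<close> by its zeros in a slightly larger disk leaves a function without zeros, for which the
  mean value property holds; each linear factor is handled by \<open>circle_mean_ln_norm_diff\<close>. A factor
  \<open>z - a\<close> contributes at least $\log\max(r,|a|)$ to the mean and $\log|a|$ to the value at the
  centre, and the difference is the term of \<open>a\<close> in the sum.
\<close>

lemma jensen_inequality:
  fixes h :: "complex \<Rightarrow> complex"
  assumes h: "h holomorphic_on ball 0 R" "h 0 \<noteq> 0" and r: "0 < r" "r < R"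
  shows "integrable angle_measure (\<lambda>t. ln (norm (h (of_real r * cis t))))"
    and "ln (norm (h 0)) + (\<Sum>a\<in>{a \<in> ball 0 r. h a = 0}. real_of_int (zorder h a) * ln (r / norm a))
           \<le> (LINT t|angle_measure. ln (norm (h (of_real r * cis t))))"
proof -
  \<comment> \<open>In the disk of radius \<open>s\<close>, relatively compact in the given one, there are finitely many zeros.\<close>
  define s where "s = (r + R) / 2"
  have s: "r < s" "s < R" "0 < s" using r by (auto simp: s_def)
  define Z where "Z = {a \<in> ball 0 s. h a = 0}"
  have "finite {a \<in> cball 0 s. h a = 0}"
    using h s by (intro finite_zeros_in_ball) auto
  hence finZ: "finite Z" by (rule finite_subset[rotated]) (auto simp: Z_def)
  define m where "m a = nat (zorder h a)" for a
  define f where "f z = (\<Prod>a\<in>Z. (z - a) ^ m a)" for z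
  have hs: "h holomorphic_on ball 0 s"
    using h(1) s by (elim holomorphic_on_subset) auto
  have zorder_h: "zorder h a > 0 \<longleftrightarrow> h a = 0" "zorder h a \<ge> 0" if "a \<in> ball 0 s" for a
  proof -
    have ev: "eventually (\<lambda>w. h w \<noteq> 0) (at a)"
      using holomorphic_eventually_nonzero[OF hs h(2) that] .
    have ana: "h analytic_on {a}"
      using hs that analytic_at open_ball by blast
    show "zorder h a > 0 \<longleftrightarrow> h a = 0" "zorder h a \<ge> 0"
      using ana ev by (auto intro!: zorder_pos_iff' zorder_ge_0 eventually_frequently)
  qed
  have "f holomorphic_on ball 0 s"
    unfolding f_def by (intro holomorphic_intros)
  moreover have "f z = 0 \<longleftrightarrow> h z = 0" if "z \<in> ball 0 s" for z
    using that finZ zorder_h[OF that] unfolding f_def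
    by (auto simp: Z_def m_def)
  moreover have "zorder f z = zorder h z" if "z \<in> ball 0 s" for z
  proof -
    have "eventually (\<lambda>w. w \<notin> Z) (at z)"
      using islimpt_finite[OF finZ, of z] by (simp add: islimpt_iff_eventually)
    hence "eventually (\<lambda>w. (\<Prod>a\<in>Z. (w - a) ^ m a) \<noteq> 0) (at z)"
      by eventually_elim (use finZ in auto)
    hence "zorder f z = (\<Sum>a\<in>Z. zorder (\<lambda>w. (w - a) ^ m a) z)"
      unfolding f_def [abs_def] by (intro zorder_prod) (auto intro!: meromorphic_intros)
    also have "\<dots> = (if z \<in> Z then int (m z) else 0)"
      using finZ by (simp add: zorder_monomial)
    also have "\<dots> = zorder h z"
      using zorder_h[OF that] that by (auto simp: Z_def m_def)
    finally show ?thesis .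
  qed
  ultimately obtain g where g: "g holomorphic_on ball 0 s" "\<And>z. z \<in> ball 0 s \<Longrightarrow> g z \<noteq> 0"
      "\<And>z. z \<in> ball 0 s \<Longrightarrow> h z = g z * f z"
    using holomorphic_zorder_factorization[of h "ball 0 s" f] hs by (metis connected_ball open_ball)
  note mean_g = circle_mean_ln_norm_nonvanishing[OF g(1,2) r(1) s(1)]
  note mean_lin = circle_mean_ln_norm_diff[OF r(1)]
  define L where "L t = ln (norm (g (of_real r * cis t))) +
      (\<Sum>a\<in>Z. real (m a) * ln (norm (of_real r * cis t - a)))" for t
  have ln_f: "ln (norm (h z)) = ln (norm (g z)) + (\<Sum>a\<in>Z. real (m a) * ln (norm (z - a)))"
    if "z \<in> ball 0 s" "z \<notin> Z" for z
  proof -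
    have "f z \<noteq> 0" using that finZ by (auto simp: f_def)
    hence "ln (norm (h z)) = ln (norm (g z)) + ln (norm (f z))"
      using g that by (simp add: norm_mult ln_mult)
    also have "ln (norm (f z)) = (\<Sum>a\<in>Z. ln (norm (z - a) ^ m a))"
      unfolding f_def prod_norm[symmetric] norm_power using that finZ by (subst ln_prod) auto
    also have "\<dots> = (\<Sum>a\<in>Z. real (m a) * ln (norm (z - a)))"
      by (intro sum.cong refl ln_realpow)
    finally show ?thesis .
  qed
  have AE_eq: "AE t in angle_measure. L t = ln (norm (h (of_real r * cis t)))"
    using AE_angle_finite[OF finZ r(1)]
    by eventually_elim (use s r in \<open>auto simp: L_def ln_f norm_mult\<close>)
  have int_L: "integrable angle_measure L"
    unfolding L_def [abs_def] using mean_g mean_lin by (intro Bochner_Integration.integrable_add Bochner_Integration.integrable_sum integrable_mult_right)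
  have cont: "continuous_on UNIV (\<lambda>t. h (of_real r * cis t))"
    using h(1) r by (intro continuous_on_circle[of "ball 0 R"] holomorphic_on_imp_continuous_on) auto
  have [measurable]: "(\<lambda>t. h (of_real r * cis t)) \<in> borel_measurable borel"
    using cont by (rule borel_measurable_continuous_onI)
  show "integrable angle_measure (\<lambda>t. ln (norm (h (of_real r * cis t))))"
    by (rule integrable_cong_AE_imp[OF int_L _ AE_eq]) simp
  have "ln (norm (h 0)) + (\<Sum>a\<in>{a \<in> ball 0 r. h a = 0}. real_of_int (zorder h a) * ln (r / norm a))
      = ln (norm (g 0)) + (\<Sum>a\<in>Z. real (m a) * ln (norm a))
        + (\<Sum>a\<in>Z. real (m a) * (ln (max r (norm a)) - ln (norm a)))"
  proof -
    have "(\<Sum>a\<in>{a \<in> ball 0 r. h a = 0}. real_of_int (zorder h a) * ln (r / norm a))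
      = (\<Sum>a\<in>Z. real (m a) * (ln (max r (norm a)) - ln (norm a)))"
    proof (rule sum.mono_neutral_cong_left[OF finZ])
      show "{a \<in> ball 0 r. h a = 0} \<subseteq> Z" using s by (auto simp: Z_def)
      show "\<forall>a\<in>Z - {a \<in> ball 0 r. h a = 0}. real (m a) * (ln (max r (norm a)) - ln (norm a)) = 0"
        by (auto simp: Z_def max_def)
      fix a assume a: "a \<in> {a \<in> ball 0 r. h a = 0}"
      have "a \<noteq> 0" using a h by auto
      thus "real_of_int (zorder h a) * ln (r / norm a) = real (m a) * (ln (max r (norm a)) - ln (norm a))"
        using a r s zorder_h[of a] by (simp add: m_def ln_div max_def)
    qed
    moreover have "0 \<notin> Z" using h by (auto simp: Z_def)
    ultimately show ?thesis using ln_f[of 0] s by simp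
  qed
  also have "\<dots> = ln (norm (g 0)) + (\<Sum>a\<in>Z. real (m a) * ln (max r (norm a)))"
    by (simp add: algebra_simps sum_subtractf)
  also have "\<dots> \<le> ln (norm (g 0)) + (\<Sum>a\<in>Z. real (m a) * (LINT t|angle_measure. ln (norm (of_real r * cis t - a))))"
    by (intro add_left_mono sum_mono mult_left_mono mean_lin) auto
  also have "\<dots> = (LINT t|angle_measure. L t)"
    unfolding L_def using mean_g mean_lin by (simp add: Bochner_Integration.integral_add Bochner_Integration.integral_sum)
  also have "\<dots> = (LINT t|angle_measure. ln (norm (h (of_real r * cis t))))"
    using AE_eq by (intro integral_cong_AE) (auto simp: int_L[THEN borel_measurable_integrable])
  finally show "ln (norm (h 0)) + (\<Sum>a\<in>{a \<in> ball 0 r. h a = 0}. real_of_int (zorder h a) * ln (r / norm a)) \<le> \<dots>" .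
qed

section \<open>Green's formula for the Fubini--Study form\<close>

lemma cis_has_vector_derivative: "(cis has_vector_derivative \<i> * cis t) (at t within S)"
proof -
  have "((\<lambda>z. exp (\<i> * z)) has_field_derivative \<i> * cis t) (at (of_real t))"
    by (auto intro!: derivative_eq_intros simp: cis_conv_exp)
  from has_vector_derivative_real_field[OF this] show ?thesis
    by (simp add: cis_conv_exp [symmetric])
qed

lemma Re_integral:
  "f integrable_on S \<Longrightarrow> Re (integral S f) = integral S (\<lambda>x. Re (f x))"
  by (rule integral_unique[symmetric], rule has_integral_Re, rule integrable_integral)

text \<open>
  The functions \<open>p\<close> and \<open>q\<close> are the homogeneous coordinates of a holomorphic map $[p:q]$ into the
  projective line. The pullback of the Fubini--Study form is \<open>fs_density\<close> times the area form, and
  $2\pi$ times this density is the Laplacian of \<open>pot\<close>. Homogeneous coordinates treat the preimages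
  of infinity and all other points alike, so this potential is smooth on the whole disk.
\<close>

locale holomorphic_pair =
  fixes p q :: "complex \<Rightarrow> complex" and R :: real
  assumes holo_p: "p holomorphic_on ball 0 R" and holo_q: "q holomorphic_on ball 0 R"
    and no_common_zero: "z \<in> ball 0 R \<Longrightarrow> p z \<noteq> 0 \<or> q z \<noteq> 0"
begin

definition sqnorm :: "complex \<Rightarrow> real" where
  "sqnorm z = (norm (p z))\<^sup>2 + (norm (q z))\<^sup>2"

definition pot :: "complex \<Rightarrow> real" where
  "pot z = ln (sqnorm z) / 2"

definition fs_density :: "complex \<Rightarrow> real" where
  "fs_density z = (norm (deriv p z * q z - p z * deriv q z))\<^sup>2 / (pi * (sqnorm z)\<^sup>2)"

text \<open>
  The Wirtinger derivative $\partial_z$ of \<open>sqnorm\<close>.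
\<close>

definition sqnorm_dz :: "complex \<Rightarrow> complex" where
  "sqnorm_dz z = deriv p z * cnj (p z) + deriv q z * cnj (q z)"

text \<open>
  The result of applying $z\,\partial_z$ to $\log$ of \<open>sqnorm\<close>. In polar coordinates
  $z=\rho e^{it}$ it is the result of applying $\rho\,\partial_\rho-i\,\partial_t$ to \<open>pot\<close>, so that
  its real part is the radial derivative that occurs in Green's formula.
\<close>

definition zdlog :: "complex \<Rightarrow> complex" where
  "zdlog z = z * sqnorm_dz z / of_real (sqnorm z)"

lemma sqnorm_pos: "z \<in> ball 0 R \<Longrightarrow> sqnorm z > 0"
  using no_common_zero[of z] by (auto simp: sqnorm_def add_nonneg_pos add_pos_nonneg)

lemma of_real_sqnorm: "of_real (sqnorm z) = p z * cnj (p z) + q z * cnj (q z)"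
  by (simp add: sqnorm_def complex_norm_square del: of_real_power)

lemma fs_density_nonneg: "fs_density z \<ge> 0"
  by (simp add: fs_density_def)

text \<open>
  Derivatives of the non-holomorphic functions below are taken along a curve \<open>z\<close> with velocity \<open>v\<close>.
  The radial and the angular direction are both instances, and the coefficients of \<open>v\<close> and \<open>cnj v\<close>
  are the two Wirtinger derivatives.
\<close>

lemma deriv_chain:
  assumes f: "f holomorphic_on ball 0 R" and z: "(z has_vector_derivative v) (at s within S)" "z s \<in> ball 0 R"
  shows "((\<lambda>s. f (z s)) has_vector_derivative v * deriv f (z s)) (at s within S)"
    and "((\<lambda>s. cnj (f (z s))) has_vector_derivative cnj v * cnj (deriv f (z s))) (at s within S)"
proof -
  have "(f has_field_derivative deriv f (z s)) (at (z s))"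
    using f z(2) by (intro holomorphic_derivI[of f "ball 0 R"]) auto
  hence "(f has_field_derivative deriv f (z s)) (at (z s) within z ` S)"
    by (rule has_field_derivative_at_within)
  from field_vector_diff_chain_within[OF z(1) this]
  show *: "((\<lambda>s. f (z s)) has_vector_derivative v * deriv f (z s)) (at s within S)"
    by (simp add: o_def)
  from has_vector_derivative_cnj[OF this]
  show "((\<lambda>s. cnj (f (z s))) has_vector_derivative cnj v * cnj (deriv f (z s))) (at s within S)"
    by simp
qed

lemma sqnorm_deriv:
  assumes z: "(z has_vector_derivative v) (at s within S)" "z s \<in> ball 0 R"
  shows "((\<lambda>s. complex_of_real (sqnorm (z s))) has_vector_derivative
            v * sqnorm_dz (z s) + cnj v * cnj (sqnorm_dz (z s))) (at s within S)"
proof -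
  note [derivative_intros] = deriv_chain[OF holo_p z] deriv_chain[OF holo_q z]
  show ?thesis
    unfolding of_real_sqnorm
    by (auto intro!: derivative_eq_intros simp: sqnorm_dz_def algebra_simps)
qed

lemma pot_deriv:
  assumes z: "(z has_vector_derivative v) (at s within S)" "z s \<in> ball 0 R"
  shows "((\<lambda>s. pot (z s)) has_vector_derivative Re (v * sqnorm_dz (z s)) / sqnorm (z s)) (at s within S)"
proof -
  have "((\<lambda>s. Re (complex_of_real (sqnorm (z s)))) has_vector_derivative
            Re (v * sqnorm_dz (z s) + cnj v * cnj (sqnorm_dz (z s)))) (at s within S)"
    using sqnorm_deriv[OF z] by (rule bounded_linear.has_vector_derivative[OF bounded_linear_Re])
  hence "((\<lambda>s. sqnorm (z s)) has_real_derivative 2 * Re (v * sqnorm_dz (z s))) (at s within S)"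
    by (simp add: has_real_derivative_iff_has_vector_derivative)
  hence "((\<lambda>s. pot (z s)) has_real_derivative Re (v * sqnorm_dz (z s)) / sqnorm (z s)) (at s within S)"
    unfolding pot_def using sqnorm_pos[OF z(2)]
    by (auto intro!: derivative_eq_intros simp: field_simps)
  thus ?thesis by (simp add: has_real_derivative_iff_has_vector_derivative)
qed

text \<open>
  The Wirtinger derivative $\partial_z$ of \<open>zdlog\<close>; the other one, $\partial_{\overline z}$, is
  $\pi z$ times \<open>fs_density\<close>.
\<close>

definition zdlog_dz :: "complex \<Rightarrow> complex" where
  "zdlog_dz z = sqnorm_dz z / of_real (sqnorm z)
     + z * (deriv (deriv p) z * cnj (p z) + deriv (deriv q) z * cnj (q z)) / of_real (sqnorm z)
     - z * (sqnorm_dz z)\<^sup>2 / (of_real (sqnorm z))\<^sup>2"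

text \<open>
  The coefficient of \<open>cnj v\<close> is found from Lagrange's identity
  $(|p'|^2+|q'|^2)(|p|^2+|q|^2)-|p'\overline p+q'\overline q|^2=|p'q-pq'|^2$.
\<close>

lemma zdlog_deriv:
  assumes z: "(z has_vector_derivative v) (at s within S)" "z s \<in> ball 0 R"
  shows "((\<lambda>s. zdlog (z s)) has_vector_derivative
            v * zdlog_dz (z s) + cnj v * (z s * of_real (pi * fs_density (z s)))) (at s within S)"
proof -
  have "deriv p holomorphic_on ball 0 R" "deriv q holomorphic_on ball 0 R"
    using holo_p holo_q by (auto intro!: holomorphic_intros)
  note chain = deriv_chain[OF holo_p z] deriv_chain[OF holo_q z]
    deriv_chain[OF this(1) z] deriv_chain[OF this(2) z]
  define N where "N = complex_of_real (sqnorm (z s))"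
  define B' where "B' = v * (deriv (deriv p) (z s) * cnj (p (z s)) + deriv (deriv q) (z s) * cnj (q (z s)))
      + cnj v * (deriv p (z s) * cnj (deriv p (z s)) + deriv q (z s) * cnj (deriv q (z s)))"
  have N0: "N \<noteq> 0" using sqnorm_pos[OF z(2)] by (simp add: N_def)
  have dB: "((\<lambda>s. sqnorm_dz (z s)) has_vector_derivative B') (at s within S)"
    unfolding sqnorm_dz_def B'_def
    by (rule derivative_eq_intros chain refl)+ (simp add: algebra_simps)
  have dN: "((\<lambda>s. inverse (complex_of_real (sqnorm (z s)))) has_vector_derivative
      (v * sqnorm_dz (z s) + cnj v * cnj (sqnorm_dz (z s))) * - (inverse N * inverse N)) (at s within S)"
  proof -
    have "(inverse has_field_derivative - (inverse N * inverse N)) (at N within (\<lambda>s. complex_of_real (sqnorm (z s))) ` S)"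
      using N0 by (auto intro!: derivative_eq_intros)
    from field_vector_diff_chain_within[OF sqnorm_deriv[OF z] this[unfolded N_def]]
    show ?thesis by (simp add: o_def N_def)
  qed
  have "((\<lambda>s. z s * sqnorm_dz (z s) * inverse (complex_of_real (sqnorm (z s)))) has_vector_derivative
      (v * sqnorm_dz (z s) + z s * B') * inverse N
        + z s * sqnorm_dz (z s) * ((v * sqnorm_dz (z s) + cnj v * cnj (sqnorm_dz (z s))) * - (inverse N * inverse N))) (at s within S)"
    by (rule derivative_eq_intros z dB dN refl)+ (simp add: N_def algebra_simps)
  also have "(v * sqnorm_dz (z s) + z s * B') * inverse N
        + z s * sqnorm_dz (z s) * ((v * sqnorm_dz (z s) + cnj v * cnj (sqnorm_dz (z s))) * - (inverse N * inverse N))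
      = v * zdlog_dz (z s) + cnj v * (z s * of_real (pi * fs_density (z s)))"
  proof -
    have W: "complex_of_real (pi * fs_density (z s))
       = ((deriv p (z s) * cnj (deriv p (z s)) + deriv q (z s) * cnj (deriv q (z s))) * N
           - sqnorm_dz (z s) * cnj (sqnorm_dz (z s))) / N\<^sup>2"
    proof -
      define w where "w = deriv p (z s) * q (z s) - p (z s) * deriv q (z s)"
      have "complex_of_real (pi * fs_density (z s)) = of_real ((norm w)\<^sup>2) / N\<^sup>2"
        by (simp add: fs_density_def N_def w_def)
      also have "of_real ((norm w)\<^sup>2) = w * cnj w"
        by (rule complex_norm_square)
      also have "w * cnj w = (deriv p (z s) * cnj (deriv p (z s)) + deriv q (z s) * cnj (deriv q (z s))) * N
           - sqnorm_dz (z s) * cnj (sqnorm_dz (z s))"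
        unfolding N_def of_real_sqnorm sqnorm_dz_def w_def by (simp add: algebra_simps)
      finally show ?thesis .
    qed
    show ?thesis
      unfolding W zdlog_dz_def N_def[symmetric] B'_def using N0 by (simp add: field_simps power2_eq_square)
  qed
  finally show ?thesis by (simp add: zdlog_def divide_inverse)
qed


lemma continuous_on_p: "continuous_on (ball 0 R) p" and continuous_on_q: "continuous_on (ball 0 R) q"
  and continuous_on_deriv_p: "continuous_on (ball 0 R) (deriv p)"
  and continuous_on_deriv_q: "continuous_on (ball 0 R) (deriv q)"
  and continuous_on_deriv2_p: "continuous_on (ball 0 R) (deriv (deriv p))"
  and continuous_on_deriv2_q: "continuous_on (ball 0 R) (deriv (deriv q))"
  using holo_p holo_q by (auto intro!: holomorphic_on_imp_continuous_on holomorphic_intros)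

lemma continuous_on_sqnorm: "continuous_on (ball 0 R) sqnorm"
  unfolding sqnorm_def by (intro continuous_intros continuous_on_p continuous_on_q)

lemma continuous_on_pot: "continuous_on (ball 0 R) pot"
  unfolding pot_def using sqnorm_pos
  by (intro continuous_intros continuous_on_sqnorm) force+

lemma continuous_on_fs_density: "continuous_on (ball 0 R) fs_density"
  unfolding fs_density_def using sqnorm_pos
  by (intro continuous_intros continuous_on_sqnorm continuous_on_p continuous_on_q
      continuous_on_deriv_p continuous_on_deriv_q) force+

lemma continuous_on_sqnorm_dz: "continuous_on (ball 0 R) sqnorm_dz"
  unfolding sqnorm_dz_def
  by (intro continuous_intros continuous_on_p continuous_on_q continuous_on_deriv_p continuous_on_deriv_q)

lemma continuous_on_zdlog: "continuous_on (ball 0 R) zdlog"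
  unfolding zdlog_def using sqnorm_pos
  by (intro continuous_intros continuous_on_sqnorm continuous_on_sqnorm_dz) force+

lemma continuous_on_zdlog_dz: "continuous_on (ball 0 R) zdlog_dz"
  unfolding zdlog_dz_def using sqnorm_pos
  by (intro continuous_intros continuous_on_sqnorm continuous_on_sqnorm_dz continuous_on_p continuous_on_q
      continuous_on_deriv2_p continuous_on_deriv2_q) force+

text \<open>
  Green's formula for the disk with the weight $\log(r/\rho)$. Let $I(\rho)$ be the integral of
  \<open>pot\<close> over the circle of radius $\rho$. Then $\rho I'(\rho)$ is the integral of the real part of
  \<open>zdlog\<close>, and the operator $\rho\,\partial_\rho+i\,\partial_t$ maps \<open>zdlog\<close> to
  $2\pi\rho^2$ times \<open>fs_density\<close>. The angular derivative integrates to zero by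
  periodicity, whence the derivative of $\rho I'(\rho)$ is $2\pi\rho$ times the integral of
  \<open>fs_density\<close> over the angle. So the integrand is the derivative of
  $\log(r/\rho)\,\rho I'(\rho)+I(\rho)$, and this extends continuously to $\rho=0$.
\<close>

lemma weighted_fs_integral_polar:
  assumes r: "0 < r" "r < R"
  shows "((\<lambda>\<rho>. ln (r / \<rho>) * (2 * pi * \<rho> * integral {0..2 * pi} (\<lambda>t. fs_density (of_real \<rho> * cis t))))
    has_integral (integral {0..2 * pi} (\<lambda>t. pot (of_real r * cis t)) - 2 * pi * pot 0)) {0..r}"
proof -
  define I where "I \<rho> = integral {0..2 * pi} (\<lambda>t. pot (of_real \<rho> * cis t))" for \<rho>
  define D where "D \<rho> = integral {0..2 * pi}
      (\<lambda>t. Re (cis t * sqnorm_dz (of_real \<rho> * cis t)) / sqnorm (of_real \<rho> * cis t))" for \<rho>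
  define J' where "J' \<rho> = 2 * pi * \<rho> * integral {0..2 * pi} (\<lambda>t. fs_density (of_real \<rho> * cis t))" for \<rho>
  have in_ball: "of_real \<rho> * cis t \<in> ball 0 R" if "\<rho> \<in> {0..r}" for \<rho> t
    using that r by (simp add: norm_mult)
  have radial: "((\<lambda>\<rho>. of_real \<rho> * cis t) has_vector_derivative cis t) (at \<rho> within S)" for t \<rho> S
    by (auto intro!: derivative_eq_intros)
  have angular: "((\<lambda>t. of_real \<rho> * cis t) has_vector_derivative \<i> * (of_real \<rho> * cis t)) (at t within S)" for t \<rho> S
  proof -
    have "((\<lambda>t. of_real \<rho> * cis t) has_vector_derivative of_real \<rho> * (\<i> * cis t)) (at t within S)"
      by (rule has_vector_derivative_mult_right[OF cis_has_vector_derivative])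
    thus ?thesis by (simp only: mult.left_commute)
  qed
  have cont2: "continuous_on ({0..r} \<times> {0..2 * pi}) (\<lambda>(\<rho>, t). f (of_real \<rho> * cis t))"
    if "continuous_on (ball 0 R) f" for f :: "complex \<Rightarrow> 'a :: topological_space"
    unfolding case_prod_unfold
    by (rule continuous_on_compose2[OF that]) (use in_ball in \<open>auto intro!: continuous_intros\<close>)
  have cont1: "continuous_on S (\<lambda>t. f (of_real \<rho> * cis t))"
    if "continuous_on (ball 0 R) f" "\<rho> \<in> {0..r}" for f :: "complex \<Rightarrow> 'a :: topological_space" and \<rho> S
    by (rule continuous_on_compose2[OF that(1)]) (use in_ball that(2) in \<open>auto intro!: continuous_intros\<close>)

  have contD: "continuous_on ({0..r} \<times> {0..2 * pi})
      (\<lambda>(\<rho>, t). Re (cis t * sqnorm_dz (of_real \<rho> * cis t)) / sqnorm (of_real \<rho> * cis t))"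
    using cont2[OF continuous_on_sqnorm_dz] cont2[OF continuous_on_sqnorm] sqnorm_pos[OF in_ball]
    unfolding case_prod_unfold by (intro continuous_intros) (auto simp: less_le)
  have I_deriv: "(I has_vector_derivative D \<rho>) (at \<rho> within {0..r})" if "\<rho> \<in> {0..r}" for \<rho>
    unfolding I_def [abs_def] D_def
    by (rule leibniz_rule_vector_derivative[where a = "0 :: real" and b = "2 * pi", unfolded cbox_interval, OF pot_deriv[OF radial in_ball] _ contD that])
       (auto intro!: integrable_continuous_real cont1 continuous_on_pot)
  have D_cont: "continuous_on {0..r} D"
    unfolding D_def [abs_def]
    by (rule integral_continuous_on_param[where a = "0 :: real" and b = "2 * pi", unfolded cbox_interval, OF contD])

  have contA': "continuous_on ({0..r} \<times> {0..2 * pi})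
      (\<lambda>(\<rho>, t). cis t * zdlog_dz (of_real \<rho> * cis t)
         + cnj (cis t) * ((of_real \<rho> * cis t) * of_real (pi * fs_density (of_real \<rho> * cis t))))"
    using cont2[OF continuous_on_zdlog_dz] cont2[OF continuous_on_fs_density]
    unfolding case_prod_unfold by (intro continuous_intros) auto
  define E where "E \<rho> t = cis t * zdlog_dz (of_real \<rho> * cis t)
         + cnj (cis t) * ((of_real \<rho> * cis t) * of_real (pi * fs_density (of_real \<rho> * cis t)))" for \<rho> t
  have zdlog_int_deriv: "((\<lambda>\<rho>. integral {0..2 * pi} (\<lambda>t. zdlog (of_real \<rho> * cis t)))
      has_vector_derivative integral {0..2 * pi} (E \<rho>)) (at \<rho> within {0..r})" if "\<rho> \<in> {0..r}" for \<rho>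
    unfolding E_def [abs_def]
    by (rule leibniz_rule_vector_derivative[where a = "0 :: real" and b = "2 * pi", unfolded cbox_interval, OF zdlog_deriv[OF radial in_ball] _ contA' that])
       (auto intro!: integrable_continuous_real cont1 continuous_on_zdlog)
  \<comment> \<open>Here \<open>V\<close> is the angular derivative of \<open>zdlog\<close>, while \<open>E\<close> is the radial one.\<close>
  have E_int: "integral {0..2 * pi} (\<lambda>t. Re (E \<rho> t)) = J' \<rho>" if \<rho>: "\<rho> \<in> {0<..r}" for \<rho>
  proof -
    define V where "V t = \<i> * (of_real \<rho> * cis t) * zdlog_dz (of_real \<rho> * cis t)
       + cnj (\<i> * (of_real \<rho> * cis t)) * ((of_real \<rho> * cis t) * of_real (pi * fs_density (of_real \<rho> * cis t)))" for t
    have "(V has_integral (zdlog (of_real \<rho> * cis (2 * pi)) - zdlog (of_real \<rho> * cis 0))) {0..2 * pi}"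
      unfolding V_def using \<rho>
      by (intro fundamental_theorem_of_calculus zdlog_deriv[OF angular in_ball]) auto
    hence "(V has_integral 0) {0..2 * pi}" by simp
    from has_integral_Im[OF this] have V0: "((\<lambda>t. Im (V t)) has_integral 0) {0..2 * pi}"
      by simp
    have "Re (E \<rho> t) = 2 * pi * \<rho> * fs_density (of_real \<rho> * cis t) + Im (V t) / \<rho>" for t
    proof -
      have "of_real \<rho> * E \<rho> t + \<i> * V t = of_real (2 * pi * \<rho>\<^sup>2 * fs_density (of_real \<rho> * cis t))"
        by (simp add: E_def V_def algebra_simps cis_cnj cis_mult power2_eq_square)
      from arg_cong[OF this, of Re] have "\<rho> * Re (E \<rho> t) - Im (V t) = 2 * pi * \<rho>\<^sup>2 * fs_density (of_real \<rho> * cis t)"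
        by simp
      thus ?thesis using \<rho> by (simp add: field_simps power2_eq_square)
    qed
    moreover have "((\<lambda>t. 2 * pi * \<rho> * fs_density (of_real \<rho> * cis t) + Im (V t) / \<rho>) has_integral (J' \<rho> + 0 / \<rho>)) {0..2 * pi}"
    proof -
      have "(\<lambda>t. fs_density (of_real \<rho> * cis t)) integrable_on {0..2 * pi}"
        using \<rho> by (intro integrable_continuous_real cont1 continuous_on_fs_density) auto
      hence "((\<lambda>t. 2 * pi * \<rho> * fs_density (of_real \<rho> * cis t)) has_integral J' \<rho>) {0..2 * pi}"
        unfolding J'_def by (intro has_integral_mult_right integrable_integral)
      moreover have "((\<lambda>t. Im (V t) / \<rho>) has_integral 0 / \<rho>) {0..2 * pi}"
        using V0 by (rule has_integral_divide)
      ultimately show ?thesis by (rule has_integral_add)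
    qed
    ultimately show ?thesis by (simp add: integral_unique)
  qed
  have J_eq: "Re (integral {0..2 * pi} (\<lambda>t. zdlog (of_real \<rho> * cis t))) = \<rho> * D \<rho>" if "\<rho> \<in> {0..r}" for \<rho>
  proof -
    have "(\<lambda>t. zdlog (of_real \<rho> * cis t)) integrable_on {0..2 * pi}"
      using that by (intro integrable_continuous_real cont1 continuous_on_zdlog)
    hence "Re (integral {0..2 * pi} (\<lambda>t. zdlog (of_real \<rho> * cis t))) = integral {0..2 * pi} (\<lambda>t. Re (zdlog (of_real \<rho> * cis t)))"
      by (rule Re_integral)
    also have "\<dots> = integral {0..2 * pi} (\<lambda>t. \<rho> * (Re (cis t * sqnorm_dz (of_real \<rho> * cis t)) / sqnorm (of_real \<rho> * cis t)))"
    proof (intro integral_cong)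
      fix t
      have "zdlog (of_real \<rho> * cis t)
          = of_real \<rho> * ((cis t * sqnorm_dz (of_real \<rho> * cis t)) / of_real (sqnorm (of_real \<rho> * cis t)))"
        by (simp only: zdlog_def mult.assoc times_divide_eq_right)
      moreover have "Re (of_real \<rho> * (w / of_real n)) = \<rho> * (Re w / n)" for w n
        by (simp add: Re_divide_of_real)
      ultimately show "Re (zdlog (of_real \<rho> * cis t))
          = \<rho> * (Re (cis t * sqnorm_dz (of_real \<rho> * cis t)) / sqnorm (of_real \<rho> * cis t))"
        by (simp only:)
    qed
    finally show ?thesis
      unfolding D_def by (simp only: integral_mult_right)
  qed
  have J_deriv: "((\<lambda>\<rho>. \<rho> * D \<rho>) has_vector_derivative J' \<rho>) (at \<rho>)" if \<rho>: "\<rho> \<in> {0<..<r}" for \<rho>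
  proof -
    have "((\<lambda>\<rho>. Re (integral {0..2 * pi} (\<lambda>t. zdlog (of_real \<rho> * cis t))))
      has_vector_derivative Re (integral {0..2 * pi} (E \<rho>))) (at \<rho> within {0..r})"
      using \<rho> by (intro bounded_linear.has_vector_derivative[OF bounded_linear_Re] zdlog_int_deriv) auto
    also have "Re (integral {0..2 * pi} (E \<rho>)) = integral {0..2 * pi} (\<lambda>t. Re (E \<rho> t))"
    proof -
      have "E \<rho> integrable_on {0..2 * pi}"
        unfolding E_def [abs_def] using \<rho>
        by (intro integrable_continuous_real continuous_intros cont1 continuous_on_zdlog_dz continuous_on_fs_density) auto
      thus ?thesis by (rule Re_integral)
    qed
    also have "\<dots> = J' \<rho>" using \<rho> by (intro E_int) auto
    finally have "((\<lambda>\<rho>. Re (integral {0..2 * pi} (\<lambda>t. zdlog (of_real \<rho> * cis t)))) has_vector_derivative J' \<rho>) (at \<rho> within {0..r})" .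
    hence "((\<lambda>\<rho>. \<rho> * D \<rho>) has_vector_derivative J' \<rho>) (at \<rho> within {0..r})"
      by (rule has_vector_derivative_transform[rotated 2]) (use \<rho> J_eq in auto)
    thus ?thesis using \<rho> by (simp add: at_within_Icc_at)
  qed
  define G where "G \<rho> = (\<rho> * ln (r / \<rho>)) * D \<rho> + I \<rho>" for \<rho>
  have c1: "continuous_on {0..r} (\<lambda>\<rho>. \<rho> * ln (r / \<rho>))"
  proof (rule continuous_on_eq_continuous_within[THEN iffD2], intro ballI)
    fix \<rho> assume \<rho>: "\<rho> \<in> {0..r}"
    show "continuous (at \<rho> within {0..r}) (\<lambda>\<rho>. \<rho> * ln (r / \<rho>))"
    proof (cases "\<rho> = 0")
      case True
      have "((\<lambda>\<rho>. \<rho> * ln (r / \<rho>)) \<longlongrightarrow> 0) (at_right 0)"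
        using r by real_asymp
      thus ?thesis using True r by (simp add: continuous_within at_within_Icc_at_right)
    next
      case False
      thus ?thesis using \<rho> r by (intro continuous_intros) auto
    qed
  qed
  have c2: "continuous_on {0..r} I"
    by (rule continuous_on_vector_derivative[OF I_deriv])
  have "continuous_on {0..r} G"
    unfolding G_def [abs_def] by (intro continuous_on_add continuous_on_mult c1 c2 D_cont)
  moreover have "(G has_vector_derivative ln (r / \<rho>) * J' \<rho>) (at \<rho>)" if \<rho>: "\<rho> \<in> {0<..<r}" for \<rho>
  proof -
    have 1: "(I has_real_derivative D \<rho>) (at \<rho>)"
      using I_deriv[of \<rho>] \<rho> by (simp add: at_within_Icc_at has_real_derivative_iff_has_vector_derivative)
    have 2: "((\<lambda>\<rho>. \<rho> * D \<rho>) has_real_derivative J' \<rho>) (at \<rho>)"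
      using J_deriv[OF \<rho>] by (simp add: has_real_derivative_iff_has_vector_derivative)
    have "((\<lambda>\<rho>. ln (r / \<rho>)) has_real_derivative - 1 / \<rho>) (at \<rho>)"
      using \<rho> r by (auto intro!: derivative_eq_intros simp: field_simps power2_eq_square)
    from DERIV_add[OF DERIV_mult[OF this 2] 1]
    have "((\<lambda>\<rho>. ln (r / \<rho>) * (\<rho> * D \<rho>) + I \<rho>) has_real_derivative ln (r / \<rho>) * J' \<rho>) (at \<rho>)"
      using \<rho> by (simp add: mult_ac)
    thus ?thesis by (simp add: G_def [abs_def] has_real_derivative_iff_has_vector_derivative mult_ac)
  qed
  ultimately have "((\<lambda>\<rho>. ln (r / \<rho>) * J' \<rho>) has_integral (G r - G 0)) {0..r}"
    using r by (intro fundamental_theorem_of_calculus_interior) auto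
  moreover have "G r = I r" "G 0 = 2 * pi * pot 0"
    using r by (simp_all add: G_def I_def)
  ultimately show ?thesis by (simp add: J'_def I_def)
qed

text \<open>
  By polar coordinates, the previous formula is one about the area measure. The left-hand side is the
  characteristic function of the map $[p:q]$.
\<close>

lemma weighted_fs_integral_eq_circle_mean:
  assumes r: "0 < r" "r < R"
  shows "(LINT z:ball 0 r|lborel. ln (r / norm z) * fs_density z)
    = (LINT t|angle_measure. pot (of_real r * cis t)) - pot 0"
proof -
  define k where "k z = indicator (ball 0 r) z *\<^sub>R fs_density z" for z
  have k_meas [measurable]: "k \<in> borel_measurable borel"
    unfolding k_def [abs_def]
    using continuous_on_subset[OF continuous_on_fs_density subset_ball, of r] r
    by (intro borel_measurable_continuous_on_indicator) auto
  define F where "F z = ln (r / norm z) * k z" for z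
  have F_meas [measurable]: "F \<in> borel_measurable borel"
    unfolding F_def [abs_def] by measurable
  have F_nonneg: "F z \<ge> 0" for z
    using r by (cases "z = 0") (auto simp: F_def k_def fs_density_nonneg indicator_def intro!: mult_nonneg_nonneg)
  define K where "K \<rho> = integral {0..2 * pi} (\<lambda>t. fs_density (of_real \<rho> * cis t))" for \<rho>
  define T where "T = integral {0..2 * pi} (\<lambda>t. pot (of_real r * cis t)) - 2 * pi * pot 0"
  have inner: "(\<integral>\<^sup>+t\<in>{0<..<2 * pi}. ennreal \<rho> * ennreal (F (of_real \<rho> * cis t)) \<partial>lborel) * indicator {0<..} \<rho>
      = ennreal (indicator {0<..<r} \<rho> * (ln (r / \<rho>) * (\<rho> * K \<rho>)))" for \<rho>
  proof (cases "\<rho> \<in> {0<..<r}")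
    case True
    have pos: "0 < ln (r / \<rho>)" using True by simp
    have "continuous_on {0..2 * pi} (\<lambda>t. fs_density (of_real \<rho> * cis t))"
      by (rule continuous_on_subset[OF continuous_on_circle[OF continuous_on_fs_density]]) (use True r in auto)
    hence "((\<lambda>t. fs_density (of_real \<rho> * cis t)) has_integral K \<rho>) {0..2 * pi}"
      unfolding K_def by (intro integrable_integral integrable_continuous_real)
    hence "((\<lambda>t. \<rho> * (ln (r / \<rho>) * fs_density (of_real \<rho> * cis t))) has_integral \<rho> * (ln (r / \<rho>) * K \<rho>)) {0..2 * pi}"
      by (intro has_integral_mult_right)
    hence "((\<lambda>t. \<rho> * (ln (r / \<rho>) * fs_density (of_real \<rho> * cis t))) has_integral \<rho> * (ln (r / \<rho>) * K \<rho>)) {0<..<2 * pi}"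
      by (subst (asm) has_integral_Icc_iff_Ioo)
    hence "(\<integral>\<^sup>+t. indicator {0<..<2 * pi} t * (\<rho> * (ln (r / \<rho>) * fs_density (of_real \<rho> * cis t))) \<partial>lborel)
        = ennreal (\<rho> * (ln (r / \<rho>) * K \<rho>))"
      using True pos by (intro nn_integral_has_integral_lebesgue mult_nonneg_nonneg fs_density_nonneg) auto
    moreover have "(\<integral>\<^sup>+t\<in>{0<..<2 * pi}. ennreal \<rho> * ennreal (F (of_real \<rho> * cis t)) \<partial>lborel)
        = (\<integral>\<^sup>+t. indicator {0<..<2 * pi} t * (\<rho> * (ln (r / \<rho>) * fs_density (of_real \<rho> * cis t))) \<partial>lborel)"
      using True by (intro nn_integral_cong)
        (auto simp: F_def k_def norm_mult indicator_def ennreal_mult' [symmetric])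
    ultimately show ?thesis using True by (simp add: mult_ac)
  next
    case False
    have "(\<integral>\<^sup>+t\<in>{0<..<2 * pi}. ennreal \<rho> * ennreal (F (of_real \<rho> * cis t)) \<partial>lborel) = 0" if "r \<le> \<rho>"
      using that r by (subst nn_integral_0_iff_AE) (auto simp: F_def k_def norm_mult)
    thus ?thesis using False by (cases "\<rho> \<le> 0") auto
  qed
  have "(\<integral>\<^sup>+z. ennreal (F z) \<partial>lborel) = (\<integral>\<^sup>+\<rho>. ennreal (indicator {0<..<r} \<rho> * (ln (r / \<rho>) * (\<rho> * K \<rho>))) \<partial>lborel)"
    by (subst nn_integral_polar_coordinates) (auto simp: inner)
  also have "\<dots> = ennreal (T / (2 * pi))"
  proof (rule nn_integral_has_integral_lebesgue)
    have "((\<lambda>\<rho>. ln (r / \<rho>) * (2 * pi * \<rho> * K \<rho>)) has_integral T) {0<..<r}"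
      using weighted_fs_integral_polar[OF r] unfolding K_def T_def by (subst (asm) has_integral_Icc_iff_Ioo)
    hence "((\<lambda>\<rho>. ln (r / \<rho>) * (2 * pi * \<rho> * K \<rho>) / (2 * pi)) has_integral T / (2 * pi)) {0<..<r}"
      by (rule has_integral_divide)
    thus "((\<lambda>\<rho>. ln (r / \<rho>) * (\<rho> * K \<rho>)) has_integral T / (2 * pi)) {0<..<r}"
      by (simp add: field_simps)
  next
    fix \<rho> assume \<rho>: "\<rho> \<in> {0<..<r}"
    have "0 \<le> K \<rho>"
      unfolding K_def by (cases "(\<lambda>t. fs_density (of_real \<rho> * cis t)) integrable_on {0..2 * pi}")
        (auto intro!: integral_nonneg fs_density_nonneg simp: not_integrable_integral)
    thus "0 \<le> ln (r / \<rho>) * (\<rho> * K \<rho>)" using \<rho> by (auto intro!: mult_nonneg_nonneg)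
  qed
  finally have nn: "(\<integral>\<^sup>+z. ennreal (F z) \<partial>lborel) = ennreal (T / (2 * pi))" .
  have "0 \<le> T"
    using weighted_fs_integral_polar[OF r] unfolding T_def
  proof (rule has_integral_nonneg)
    fix \<rho> assume \<rho>: "\<rho> \<in> {0..r}"
    have "0 \<le> integral {0..2 * pi} (\<lambda>t. fs_density (of_real \<rho> * cis t))"
      by (cases "(\<lambda>t. fs_density (of_real \<rho> * cis t)) integrable_on {0..2 * pi}")
        (auto intro!: integral_nonneg fs_density_nonneg simp: not_integrable_integral)
    moreover have "0 \<le> ln (r / \<rho>)" using \<rho> r by (cases "\<rho> = 0") auto
    ultimately show "0 \<le> ln (r / \<rho>) * (2 * pi * \<rho> * integral {0..2 * pi} (\<lambda>t. fs_density (of_real \<rho> * cis t)))"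
      using \<rho> by (intro mult_nonneg_nonneg) auto
  qed
  have "(LINT z:ball 0 r|lborel. ln (r / norm z) * fs_density z) = (LINT z|lborel. F z)"
    unfolding set_lebesgue_integral_def
    by (intro Bochner_Integration.integral_cong) (auto simp: F_def k_def mult_ac)
  also have "\<dots> = T / (2 * pi)"
    using \<open>0 \<le> T\<close> by (subst integral_eq_nn_integral) (auto simp: F_nonneg nn)
  also have "\<dots> = (LINT t|angle_measure. pot (of_real r * cis t)) - pot 0"
  proof -
    have "continuous_on UNIV (\<lambda>t. pot (of_real r * cis t))"
      using r by (intro continuous_on_circle[OF continuous_on_pot]) auto
    from integral_angle_continuous[OF this] show ?thesis
      by (simp add: T_def field_simps)
  qed
  finally show ?thesis .
qed

end

section \<open>Meromorphic functions as maps into the sphere\<close>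

text \<open>
  The function \<open>f\<close> may be any function: a simple function below \<open>f\<close> pulls back to a measurable
  function below $f\circ T$. In the application \<open>f\<close> is \<open>green_push\<close>, whose measurability would
  require an argument of its own.
\<close>

lemma nn_integral_distr_le:
  assumes T: "T \<in> measurable M N"
  shows "(\<integral>\<^sup>+y. f y \<partial>distr M N T) \<le> (\<integral>\<^sup>+x. f (T x) \<partial>M)"
  unfolding nn_integral_def[of "distr M N T"]
proof (rule SUP_least)
  fix g assume "g \<in> {g. simple_function (distr M N T) g \<and> g \<le> f}"
  hence g: "simple_function (distr M N T) g" "g \<le> f" by auto
  have "g \<in> borel_measurable N"
    using borel_measurable_simple_function[OF g(1)] by simp
  have "integral\<^sup>S (distr M N T) g = (\<integral>\<^sup>+y. g y \<partial>distr M N T)"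
    using g(1) by (rule nn_integral_eq_simple_integral[symmetric])
  also have "\<dots> = (\<integral>\<^sup>+x. g (T x) \<partial>M)"
    using T \<open>g \<in> borel_measurable N\<close> by (intro nn_integral_distr) auto
  also have "\<dots> \<le> (\<integral>\<^sup>+x. f (T x) \<partial>M)"
    using g(2) by (intro nn_integral_mono) (auto simp: le_fun_def)
  finally show "integral\<^sup>S (distr M N T) g \<le> (\<integral>\<^sup>+x. f (T x) \<partial>M)" .
qed

lemma zorder_unit_mult:
  fixes f u g :: "complex \<Rightarrow> complex"
  assumes "open S" "x \<in> S" "u holomorphic_on S" "g holomorphic_on S" "u x \<noteq> 0"
    and "\<And>z. z \<in> S \<Longrightarrow> f z = u z * g z" and "eventually (\<lambda>z. g z \<noteq> 0) (at x)"
  shows "zorder f x = zorder g x"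
proof -
  have an: "u analytic_on {x}" "g analytic_on {x}"
    using assms analytic_at by blast+
  have "eventually (\<lambda>z. z \<in> S) (nhds x)"
    using assms by (intro eventually_nhds_in_open)
  hence "eventually (\<lambda>z. f z = u z * g z) (at x)"
    unfolding eventually_at_filter by eventually_elim (simp add: assms)
  hence "zorder f x = zorder (\<lambda>z. u z * g z) x"
    by (intro zorder_cong) auto
  also have "\<dots> = zorder u x + zorder g x"
  proof (rule zorder_mult)
    have "eventually (\<lambda>z. u z \<noteq> 0) (at x)"
      using an(1) assms(5) by (simp add: analytic_at_neq_imp_eventually_neq)
    thus "frequently (\<lambda>z. u z \<noteq> 0) (at x)"
      by (simp add: eventually_frequently)
    show "frequently (\<lambda>z. g z \<noteq> 0) (at x)"
      using assms(7) by (simp add: eventually_frequently)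
  qed (use an in \<open>auto intro: analytic_on_imp_meromorphic_on\<close>)
  also have "zorder u x = 0"
    using an(1) assms(5) by (rule zorder_eq_0I)
  finally show ?thesis by simp
qed

text \<open>
  Written in homogeneous coordinates, the density is symmetric in \<open>f\<close> and \<open>g\<close> up to a sign inside the
  norm. This is why one formula serves for both charts of the sphere.
\<close>

lemma pullback_fubini_study_quotient:
  assumes S: "open S" "z \<in> S" and f: "f holomorphic_on S" and g: "g holomorphic_on S" "g z \<noteq> 0"
    and F: "\<And>w. w \<in> S \<Longrightarrow> F w = f w / g w"
  shows "pullback F fubini_study z 1 \<i>
    = (norm (deriv f z * g z - f z * deriv g z))\<^sup>2 / (pi * ((norm (f z))\<^sup>2 + (norm (g z))\<^sup>2)\<^sup>2)"
proof -
  define d where "d = (deriv f z * g z - f z * deriv g z) / (g z)\<^sup>2"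
  have df: "(f has_field_derivative deriv f z) (at z)" and dg: "(g has_field_derivative deriv g z) (at z)"
    using S f g by (auto intro: holomorphic_derivI)
  have "((\<lambda>w. f w / g w) has_field_derivative d) (at z)"
    using df dg g(2) by (auto intro!: derivative_eq_intros simp: d_def power2_eq_square)
  hence "(F has_field_derivative d) (at z)"
    by (rule has_field_derivative_transform_within_open[OF _ S]) (simp add: F)
  hence fd: "frechet_derivative F (at z) = (*) d"
    using frechet_derivative_at[of F "(*) d" z] by (simp add: has_field_derivative_def)
  have "pullback F fubini_study z 1 \<i> = (norm d)\<^sup>2 / (pi * (1 + (norm (F z))\<^sup>2)\<^sup>2)"
  proof -
    have "d * cnj (d * \<i>) - (d * \<i>) * cnj d = -2 * \<i> * of_real ((norm d)\<^sup>2)"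
      by (simp only: complex_norm_square) (simp add: algebra_simps)
    hence "\<i> / (2 * of_real pi) * (d * cnj (d * \<i>) - (d * \<i>) * cnj d) / of_real ((1 + (norm (F z))\<^sup>2)\<^sup>2)
        = of_real ((norm d)\<^sup>2 / (pi * (1 + (norm (F z))\<^sup>2)\<^sup>2))"
      by simp
    thus ?thesis
      unfolding pullback_def fubini_study_def fd by (simp only: mult_1_right Re_complex_of_real)
  qed
  also have "\<dots> = (norm (deriv f z * g z - f z * deriv g z))\<^sup>2 / (pi * ((norm (f z))\<^sup>2 + (norm (g z))\<^sup>2)\<^sup>2)"
  proof -
    define n where "n = norm (g z)"
    have n: "n \<noteq> 0" using g by (simp add: n_def)
    have "1 + (norm (F z))\<^sup>2 = ((norm (f z))\<^sup>2 + n\<^sup>2) / n\<^sup>2"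
      using n S by (simp add: F norm_divide n_def power_divide field_simps)
    moreover have "norm d = norm (deriv f z * g z - f z * deriv g z) / n\<^sup>2"
      by (simp add: d_def norm_divide norm_power n_def)
    ultimately show ?thesis
      unfolding n_def[symmetric] using n by (simp add: power_divide)
  qed
  finally show ?thesis .
qed

locale meromorphic_quotient = holomorphic_pair +
  fixes \<alpha> :: "complex \<Rightarrow> complex"
  assumes quotient: "z \<in> ball 0 R \<Longrightarrow> \<alpha> z = p z / q z"
    and pole_iff: "z \<in> ball 0 R \<Longrightarrow> is_pole \<alpha> z \<longleftrightarrow> q z = 0"
begin

lemma pullback_FS_eq_fs_density:
  assumes z: "z \<in> ball 0 R"
  shows "pullback_FS \<alpha> z 1 \<i> = fs_density z"
proof (cases "q z = 0")
  case True
  hence "p z \<noteq> 0" using no_common_zero[OF z] by simp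
  have "pullback (\<lambda>z. inverse (\<alpha> z)) fubini_study z 1 \<i>
     = (norm (deriv q z * p z - q z * deriv p z))\<^sup>2 / (pi * ((norm (q z))\<^sup>2 + (norm (p z))\<^sup>2)\<^sup>2)"
    by (rule pullback_fubini_study_quotient[OF open_ball z holo_q holo_p \<open>p z \<noteq> 0\<close>])
       (simp add: quotient)
  also have "norm (deriv q z * p z - q z * deriv p z) = norm (deriv p z * q z - p z * deriv q z)"
    by (subst norm_minus_commute) (simp add: mult_ac)
  finally show ?thesis
    using True pole_iff[OF z] by (simp add: pullback_FS_def fs_density_def sqnorm_def add.commute)
next
  case False
  have "pullback \<alpha> fubini_study z 1 \<i>
     = (norm (deriv p z * q z - p z * deriv q z))\<^sup>2 / (pi * ((norm (p z))\<^sup>2 + (norm (q z))\<^sup>2)\<^sup>2)"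
    by (rule pullback_fubini_study_quotient[OF open_ball z holo_p holo_q False]) (simp add: quotient)
  thus ?thesis
    using False pole_iff[OF z] by (simp add: pullback_FS_def fs_density_def sqnorm_def)
qed

lemma char_fun_eq:
  assumes "0 < r" "r < R"
  shows "char_fun \<alpha> r = (LINT t|angle_measure. pot (of_real r * cis t)) - pot 0"
proof -
  have "char_fun \<alpha> r = (LINT z:ball 0 r|lborel. ln (r / norm z) * fs_density z)"
    unfolding char_fun_def set_lebesgue_integral_def
    using assms by (intro Bochner_Integration.integral_cong) (auto simp: indicator_def pullback_FS_eq_fs_density)
  thus ?thesis using weighted_fs_integral_eq_circle_mean[OF assms] by simp
qed

text \<open>
  The poles on the circle form a closed set, and off this set the map is the continuous function
  $p/q$.
\<close>

lemma sphere_map_measurable: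
  assumes r: "r < R"
  shows "sphere_map \<alpha> \<in> measurable (restrict_space borel (sphere 0 r)) P1_borel"
  unfolding P1_borel_def
proof -
  have opens: "{U. openin P1 U} \<subseteq> Pow (topspace P1)"
    using openin_subset by auto
  show "sphere_map \<alpha> \<in> measurable (restrict_space borel (sphere 0 r)) (sigma (topspace P1) {U. openin P1 U})"
  proof (rule measurable_sigma_sets[OF sets_measure_of[OF opens] opens])
    show "sphere_map \<alpha> \<in> space (restrict_space borel (sphere 0 r)) \<rightarrow> topspace P1"
      by (auto simp: P1_def sphere_map_def)
    fix U assume "U \<in> {U. openin P1 U}"
    hence U: "openin P1 U" by simp
    define V where "V = {v. Some v \<in> U}"
    have V: "open V"
      using U unfolding P1_def openin_Alexandroff_compactification
    proof (elim disjE exE conjE)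
      fix W assume "openin euclidean W" "U = Some ` W"
      thus "open V" by (simp add: V_def image_iff)
    next
      fix C assume C: "compactin euclidean C" "U = insert None (Some ` (topspace euclidean - C))"
      hence "V = - C" by (auto simp: V_def)
      thus "open V" using C by (simp add: compact_imp_closed open_Compl)
    qed
    have sub: "sphere 0 r \<subseteq> ball 0 R" using r by auto
    have cont_p: "continuous_on (sphere 0 r) p" and cont_q: "continuous_on (sphere 0 r) q"
      using continuous_on_p continuous_on_q sub by (blast intro: continuous_on_subset)+
    define Q where "Q = sphere 0 r \<inter> q -` {0}"
    have Q: "Q \<in> sets borel"
      unfolding Q_def using cont_q by (intro borel_closed continuous_closed_preimage) auto
    have cont: "continuous_on (sphere 0 r - Q) (\<lambda>z. p z / q z)"
      using continuous_on_subset[OF cont_p] continuous_on_subset[OF cont_q]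
      by (intro continuous_on_divide) (auto simp: Q_def)
    have split: "sphere_map \<alpha> -` U \<inter> sphere 0 r
        = ((\<lambda>z. p z / q z) -` V \<inter> (sphere 0 r - Q)) \<union> (if None \<in> U then Q else {})"
    proof -
      have "sphere_map \<alpha> z = (if q z = 0 then None else Some (p z / q z))" if "norm z = r" for z
        using that r by (simp add: sphere_map_def pole_iff quotient)
      thus ?thesis by (auto simp: V_def Q_def split: if_splits)
    qed
    have fin_part: "(\<lambda>z. p z / q z) -` V \<inter> (sphere 0 r - Q) \<in> sets borel"
    proof -
      have *: "sphere 0 r - Q \<in> sets borel"
        by (rule sets.Diff[OF borel_closed[OF closed_sphere] Q])
      have "(\<lambda>z. p z / q z) \<in> borel_measurable (restrict_space borel (sphere 0 r - Q))"
        using cont by (rule borel_measurable_continuous_on_restrict)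
      from measurable_sets[OF this borel_open[OF V]] * show ?thesis
        by (simp add: sets_restrict_space_iff space_restrict_space)
    qed
    have inf_part: "(if None \<in> U then Q else {}) \<in> sets borel"
      using Q by auto
    have "sphere_map \<alpha> -` U \<inter> sphere 0 r \<in> sets borel"
      unfolding split by (rule sets.Un[OF fin_part inf_part])
    thus "sphere_map \<alpha> -` U \<inter> space (restrict_space borel (sphere 0 r)) \<in> sets (restrict_space borel (sphere 0 r))"
      by (simp add: sets_restrict_space_iff space_restrict_space)
  qed
qed

lemma nn_integral_circle_image_le:
  assumes r: "0 < r" "r < R"
  shows "(\<integral>\<^sup>+y. f y \<partial>distr (circle_measure r) P1_borel (sphere_map \<alpha>))
    \<le> (\<integral>\<^sup>+t. f (sphere_map \<alpha> (of_real r * cis t)) \<partial>angle_measure)"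
proof -
  have T: "(\<lambda>t. of_real r * cis t) \<in> measurable angle_measure (restrict_space borel (sphere 0 r))"
  proof (rule measurable_restrict_space2)
    have "(\<lambda>t. complex_of_real r * cis t) \<in> borel_measurable borel"
      by (intro borel_measurable_continuous_onI continuous_intros)
    thus "(\<lambda>t. complex_of_real r * cis t) \<in> borel_measurable angle_measure"
      by simp
  qed (use r in \<open>auto simp: norm_mult\<close>)
  have "sphere_map \<alpha> \<in> measurable (circle_measure r) P1_borel"
    using sphere_map_measurable[OF r(2)] by (simp add: circle_measure_def)
  from nn_integral_distr_le[OF this, of f]
  have "(\<integral>\<^sup>+y. f y \<partial>distr (circle_measure r) P1_borel (sphere_map \<alpha>))
      \<le> (\<integral>\<^sup>+z. f (sphere_map \<alpha> z) \<partial>circle_measure r)" .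
  also have "\<dots> \<le> (\<integral>\<^sup>+t. f (sphere_map \<alpha> (of_real r * cis t)) \<partial>angle_measure)"
    unfolding circle_measure_def by (rule nn_integral_distr_le[OF T])
  finally show ?thesis .
qed

text \<open>
  The determinant of the homogeneous coordinates at two points. As a function of \<open>z\<close>, it is
  holomorphic with the same zeros, counted with multiplicity, as the equation
  $\alpha(z)=\alpha(w)$ on the sphere, even if \<open>w\<close> or \<open>z\<close> is a pole. Divided by the lengths of the
  two coordinate vectors, its modulus is the chordal distance between $\alpha(w)$ and
  $\alpha(z)$.
\<close>

definition cross :: "complex \<Rightarrow> complex \<Rightarrow> complex" where
  "cross w z = q w * p z - p w * q z"

lemma cross_holomorphic: "cross w holomorphic_on ball 0 R"
  unfolding cross_def [abs_def] by (intro holomorphic_intros holo_p holo_q)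

lemma sphere_map_eq_iff_cross:
  assumes "w \<in> ball 0 R" "z \<in> ball 0 R"
  shows "sphere_map \<alpha> z = sphere_map \<alpha> w \<longleftrightarrow> cross w z = 0"
  using no_common_zero[OF assms(1)] no_common_zero[OF assms(2)] assms
  by (auto simp: sphere_map_def pole_iff quotient cross_def field_simps)

text \<open>
  The Cauchy--Schwarz inequality; in other words, the chordal distance is at most one.
\<close>

lemma ln_norm_cross_le:
  assumes "w \<in> ball 0 R" "z \<in> ball 0 R" "cross w z \<noteq> 0"
  shows "ln (norm (cross w z)) \<le> pot w + pot z"
proof -
  have "norm (cross w z) \<le> norm (q w) * norm (p z) + norm (p w) * norm (q z)"
    unfolding cross_def using norm_triangle_ineq4[of "q w * p z" "p w * q z"] by (simp add: norm_mult)
  hence "(norm (cross w z))\<^sup>2 \<le> (norm (q w) * norm (p z) + norm (p w) * norm (q z))\<^sup>2"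
    by (rule power_mono) simp
  also have "\<dots> = sqnorm w * sqnorm z - (norm (q w) * norm (q z) - norm (p w) * norm (p z))\<^sup>2"
    by (simp add: sqnorm_def power2_eq_square algebra_simps)
  also have "\<dots> \<le> sqnorm w * sqnorm z"
    by simp
  finally have "ln ((norm (cross w z))\<^sup>2) \<le> ln (sqnorm w * sqnorm z)"
    using assms sqnorm_pos by (subst ln_le_cancel_iff) auto
  also have "\<dots> = ln (sqnorm w) + ln (sqnorm z)"
    using sqnorm_pos[OF assms(1)] sqnorm_pos[OF assms(2)] by (simp add: ln_mult)
  finally show ?thesis using assms(3) by (simp add: pot_def ln_realpow)
qed

lemma ram_index_eq_zorder_cross:
  assumes w: "w \<in> ball 0 R" and x: "x \<in> ball 0 R" "cross w x = 0"
    and nz: "eventually (\<lambda>z. cross w z \<noteq> 0) (at x)"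
  shows "int (ram_index \<alpha> x) = zorder (cross w) x"
proof -
  have an: "cross w analytic_on {x}"
    using cross_holomorphic x(1) analytic_at open_ball by blast
  have nonneg: "zorder (cross w) x \<ge> 0"
    using an nz by (intro zorder_ge_0 eventually_frequently) auto
  have eq: "sphere_map \<alpha> x = sphere_map \<alpha> w"
    using sphere_map_eq_iff_cross[OF w x(1)] x(2) by simp
  show ?thesis
  proof (cases "q x = 0")
    case True
    hence px: "p x \<noteq> 0" using no_common_zero[OF x(1)] by simp
    have qw: "q w = 0" using eq True w x by (auto simp: sphere_map_def pole_iff split: if_splits)
    hence pw: "p w \<noteq> 0" using no_common_zero[OF w] by simp
    define S where "S = ball 0 R \<inter> p -` (- {0})"
    have S: "open S" "x \<in> S"
      unfolding S_def using px x continuous_on_p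
      by (auto intro!: continuous_open_preimage)
    have "zorder (\<lambda>z. inverse (\<alpha> z)) x = zorder (cross w) x"
    proof (rule zorder_unit_mult[OF S])
      show "(\<lambda>z. - 1 / (p w * p z)) holomorphic_on S"
        using holo_p pw by (auto intro!: holomorphic_intros elim: holomorphic_on_subset simp: S_def)
      show "cross w holomorphic_on S"
        using cross_holomorphic by (rule holomorphic_on_subset) (auto simp: S_def)
      show "inverse (\<alpha> z) = - 1 / (p w * p z) * cross w z" if "z \<in> S" for z
        using that pw by (simp add: cross_def qw S_def quotient)
    qed (use px pw nz in auto)
    thus ?thesis using True x nonneg by (simp add: ram_index_def pole_iff)
  next
    case False
    hence qw: "q w \<noteq> 0" using eq w x by (auto simp: sphere_map_def pole_iff split: if_splits)
    have val: "\<alpha> x = p w / q w"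
      using eq False qw w x by (auto simp: sphere_map_def pole_iff quotient)
    define S where "S = ball 0 R \<inter> q -` (- {0})"
    have S: "open S" "x \<in> S"
      unfolding S_def using False x continuous_on_q
      by (auto intro!: continuous_open_preimage)
    have "zorder (\<lambda>z. \<alpha> z - \<alpha> x) x = zorder (cross w) x"
    proof (rule zorder_unit_mult[OF S])
      show "(\<lambda>z. 1 / (q w * q z)) holomorphic_on S"
        using holo_q qw by (auto intro!: holomorphic_intros elim: holomorphic_on_subset simp: S_def)
      show "cross w holomorphic_on S"
        using cross_holomorphic by (rule holomorphic_on_subset) (auto simp: S_def)
      show "\<alpha> z - \<alpha> x = 1 / (q w * q z) * cross w z" if "z \<in> S" for z
        using that qw unfolding val by (simp add: cross_def S_def quotient field_simps)
    qed (use False qw nz in auto)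
    thus ?thesis using False x nonneg by (simp add: ram_index_def pole_iff)
  qed
qed


text \<open>
  Points on the boundary circle have Green function zero, so only the open disk contributes.
\<close>

lemma sum_green_eq:
  assumes h: "h holomorphic_on ball 0 R" "h 0 \<noteq> 0" and r: "0 < r" "r < R"
    and Z: "Z = {x \<in> cball 0 r. h x = 0}"
    and ram: "\<And>x. x \<in> Z \<Longrightarrow> int (ram_index \<alpha> x) = zorder h x"
  shows "(\<Sum>x\<in>Z. of_nat (ram_index \<alpha> x) * green r x)
    = ennreal (\<Sum>a\<in>{a \<in> ball 0 r. h a = 0}. real_of_int (zorder h a) * ln (r / norm a))"
proof -
  have fin: "finite Z"
    unfolding Z using h r by (intro finite_zeros_in_ball) auto
  have zorder_ram: "zorder h x = int (ram_index \<alpha> x)" if "x \<in> Z" for x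
    using ram[OF that] by simp
  have "(\<Sum>x\<in>Z. of_nat (ram_index \<alpha> x) * green r x)
      = (\<Sum>x\<in>{x \<in> ball 0 r. h x = 0}. of_nat (ram_index \<alpha> x) * green r x)"
    by (rule sum.mono_neutral_right[OF fin]) (use r in \<open>auto simp: Z green_def\<close>)
  also have "\<dots> = (\<Sum>a\<in>{a \<in> ball 0 r. h a = 0}. ennreal (real_of_int (zorder h a) * ln (r / norm a)))"
  proof (rule sum.cong[OF refl])
    fix a assume a: "a \<in> {a \<in> ball 0 r. h a = 0}"
    hence "a \<noteq> 0" using h by auto
    moreover have "real_of_int (zorder h a) = real (ram_index \<alpha> a)"
      using zorder_ram[of a] a by (simp add: Z)
    moreover have "0 \<le> ln (r / norm a)" using a \<open>a \<noteq> 0\<close> by simp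
    ultimately show "of_nat (ram_index \<alpha> a) * green r a = ennreal (real_of_int (zorder h a) * ln (r / norm a))"
      by (simp add: green_def ennreal_mult ennreal_of_nat_eq_real_of_nat max_def)
  qed
  also have "\<dots> = ennreal (\<Sum>a\<in>{a \<in> ball 0 r. h a = 0}. real_of_int (zorder h a) * ln (r / norm a))"
  proof (rule sum_ennreal)
    fix a assume a: "a \<in> {a \<in> ball 0 r. h a = 0}"
    hence "a \<noteq> 0" using h by auto
    have "zorder h a \<ge> 0" using zorder_ram[of a] a by (simp add: Z)
    thus "0 \<le> real_of_int (zorder h a) * ln (r / norm a)" using a \<open>a \<noteq> 0\<close> by simp
  qed
  finally show ?thesis .
qed

text \<open>
  This is one half of Nevanlinna's first main theorem. By Jensen's inequality for \<open>cross w\<close>, the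
  counting function of the value $\alpha(w)$ is at most the circle mean of \<open>ln (norm (cross w z))\<close>
  minus its value at \<open>z = 0\<close>. The chordal distance being at most one bounds the mean, and
  antisymmetry turns the value at the centre into \<open>cross 0 w\<close>.
\<close>

lemma green_push_le:
  assumes r: "0 < r" "r < R" and w: "w \<in> ball 0 R" "cross 0 w \<noteq> 0"
  shows "0 \<le> pot w + (LINT t|angle_measure. pot (of_real r * cis t)) - ln (norm (cross 0 w))"
    and "green_push \<alpha> r (sphere_map \<alpha> w)
      \<le> ennreal (pot w + (LINT t|angle_measure. pot (of_real r * cis t)) - ln (norm (cross 0 w)))"
proof -
  have c0: "cross w 0 = - cross 0 w" by (simp add: cross_def)
  hence nz: "cross w 0 \<noteq> 0" using w by simp
  define S where "S = (\<Sum>a\<in>{a \<in> ball 0 r. cross w a = 0}. real_of_int (zorder (cross w) a) * ln (r / norm a))"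
  have in_ball: "of_real r * cis t \<in> ball 0 R" for t using r by (simp add: norm_mult)
  have ram: "int (ram_index \<alpha> x) = zorder (cross w) x" if "x \<in> cball 0 r" "cross w x = 0" for x
  proof -
    have x: "x \<in> ball 0 R" using that r by auto
    show ?thesis
      using holomorphic_eventually_nonzero[OF cross_holomorphic nz x] that
      by (intro ram_index_eq_zorder_cross[OF w(1) x])
  qed
  have set_eq: "{x \<in> cball 0 r. sphere_map \<alpha> x = sphere_map \<alpha> w} = {x \<in> cball 0 r. cross w x = 0}"
    using r by (intro Collect_cong conj_cong refl sphere_map_eq_iff_cross[OF w(1)]) auto
  have push: "green_push \<alpha> r (sphere_map \<alpha> w) = ennreal S"
    unfolding green_push_def S_def
    by (rule sum_green_eq[OF cross_holomorphic nz r set_eq]) (use set_eq ram in blast)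
  note jensen = jensen_inequality[OF cross_holomorphic nz r]
  have pot_cont: "continuous_on UNIV (\<lambda>t. pot (of_real r * cis t))"
    using r by (intro continuous_on_circle[OF continuous_on_pot]) auto
  have pot_int: "integrable angle_measure (\<lambda>t. pot (of_real r * cis t))"
    using pot_cont by (rule integrable_angle_continuous)
  have "finite {x \<in> cball 0 r. cross w x = 0}"
    using cross_holomorphic nz r by (intro finite_zeros_in_ball) auto
  from AE_angle_finite[OF this r(1)]
  have "AE t in angle_measure. ln (norm (cross w (of_real r * cis t))) \<le> pot w + pot (of_real r * cis t)"
  proof eventually_elim
    case (elim t)
    thus ?case using r in_ball by (intro ln_norm_cross_le w(1)) (auto simp: norm_mult)
  qed
  hence "(LINT t|angle_measure. ln (norm (cross w (of_real r * cis t))))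
      \<le> (LINT t|angle_measure. pot w + pot (of_real r * cis t))"
    using jensen(1) pot_int by (intro integral_mono_AE Bochner_Integration.integrable_add) auto
  also have "\<dots> = pot w + (LINT t|angle_measure. pot (of_real r * cis t))"
    using pot_int by (simp add: angle.prob_space)
  finally have le: "S \<le> pot w + (LINT t|angle_measure. pot (of_real r * cis t)) - ln (norm (cross 0 w))"
    using jensen(2) c0 by (simp add: S_def)
  have "0 \<le> S"
    unfolding S_def
  proof (rule sum_nonneg)
    fix a assume a: "a \<in> {a \<in> ball 0 r. cross w a = 0}"
    hence "a \<noteq> 0" using nz by auto
    moreover have "0 \<le> zorder (cross w) a" using ram[of a, symmetric] a by simp
    ultimately show "0 \<le> real_of_int (zorder (cross w) a) * ln (r / norm a)" using a by simp
  qed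
  with le show "0 \<le> pot w + (LINT t|angle_measure. pot (of_real r * cis t)) - ln (norm (cross 0 w))"
    by linarith
  show "green_push \<alpha> r (sphere_map \<alpha> w)
      \<le> ennreal (pot w + (LINT t|angle_measure. pot (of_real r * cis t)) - ln (norm (cross 0 w)))"
    unfolding push using le by (rule ennreal_leI)
qed

end

section \<open>The estimate of the overflow\<close>

text \<open>
  On a disk relatively compact in the domain, zeros and poles cannot accumulate at the boundary, so
  the Weierstrass factorization applies there.
\<close>

lemma meromorphic_quotient_exists:
  assumes mero: "\<alpha> nicely_meromorphic_on eball 0 R" and nc: "\<not> \<alpha> constant_on eball 0 R"
    and s: "0 < s" "ereal s < R"
  obtains p q where "meromorphic_quotient p q s \<alpha>"
proof -
  have sub: "cball (0 :: complex) s \<subseteq> eball 0 R"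
  proof
    fix x :: complex assume "x \<in> cball 0 s"
    hence "ereal (dist 0 x) \<le> ereal s" by simp
    also have "\<dots> < R" by fact
    finally show "x \<in> eball 0 R" by simp
  qed
  have mero': "\<alpha> nicely_meromorphic_on ball 0 s"
    by (rule nicely_meromorphic_on_subset[OF mero order_trans[OF ball_subset_cball sub]])
  have no_limpt: "\<not> z islimpt {w \<in> ball 0 s. \<alpha> w = 0 \<or> is_pole \<alpha> w}" if z: "z \<in> frontier (ball 0 s)" for z
  proof
    assume lim: "z islimpt {w \<in> ball 0 s. \<alpha> w = 0 \<or> is_pole \<alpha> w}"
    have "{w \<in> ball 0 s. \<alpha> w = 0 \<or> is_pole \<alpha> w} \<subseteq> {w. \<alpha> w = 0}"
      using is_pole_zero_at_nicely_mero[OF mero'] by auto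
    hence "z islimpt {w. \<alpha> w = 0}" using lim islimpt_subset by blast
    hence freq: "frequently (\<lambda>w. \<alpha> w = 0) (at z)"
      by (simp add: islimpt_conv_frequently_at)
    have "z \<in> eball 0 R" using z s sub by (auto simp: frontier_ball)
    hence "\<alpha> w = 0" if "w \<in> eball 0 R" for w
      using frequently_eq_meromorphic_imp_constant[OF freq mero] that by blast
    thus False using nc by (auto simp: constant_on_def)
  qed
  show ?thesis
  proof (rule weierstrass_factorization_meromorphic[OF mero' open_ball connected_ball no_limpt])
    fix h f1 f2
    assume h: "h holomorphic_on ball 0 s" "\<forall>z\<in>ball 0 s. h z \<noteq> 0"
      and f1: "f1 holomorphic_on UNIV" "\<forall>z\<in>ball 0 s. f1 z = 0 \<longleftrightarrow> \<not> is_pole \<alpha> z \<and> \<alpha> z = 0"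
      and f2: "f2 holomorphic_on UNIV" "\<forall>z\<in>ball 0 s. f2 z = 0 \<longleftrightarrow> is_pole \<alpha> z"
      and \<alpha>: "\<forall>z\<in>ball 0 s. \<alpha> z = h z * f1 z / f2 z"
    have "meromorphic_quotient (\<lambda>z. h z * f1 z) f2 s \<alpha>"
    proof
      show "(\<lambda>z. h z * f1 z) holomorphic_on ball 0 s"
        using h(1) holomorphic_on_subset[OF f1(1)] by (intro holomorphic_intros) auto
      show "f2 holomorphic_on ball 0 s"
        using f2(1) by (rule holomorphic_on_subset) simp
    qed (use h(2) f1(2) f2(2) \<alpha> in auto)
    thus ?thesis by (rule that)
  qed
qed

context meromorphic_quotient
begin

text \<open>
  Near the origin, $\alpha(z)-\alpha(0)$ is \<open>cross 0 z\<close> divided by $q(0)\,q(z)$. Hence the leading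
  coefficient of \<open>cross 0\<close> is $q(0)^2$ times the first nonvanishing Taylor coefficient of
  $\alpha-\alpha(0)$.
\<close>

lemma cross_0_factor:
  assumes nc: "\<exists>z\<in>ball 0 R. cross 0 z \<noteq> 0" and R: "0 < R" and q0: "q 0 \<noteq> 0"
  defines "e \<equiv> ram_index \<alpha> 0"
  obtains k where "k holomorphic_on ball 0 R" "k 0 \<noteq> 0" "\<And>z. z \<in> ball 0 R \<Longrightarrow> cross 0 z = z ^ e * k z"
    "norm (k 0) = (norm (q 0))\<^sup>2 * norm ((deriv ^^ e) \<alpha> 0 / fact e)"
proof -
  have 0: "0 \<in> ball 0 R" using R by simp
  have c0: "cross 0 0 = 0" by (simp add: cross_def)
  define g where "g = zor_poly (cross 0) 0"
  have pos: "zorder (cross 0) 0 > 0"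
    using zorder_exist_zero[OF cross_holomorphic open_ball connected_ball 0 nc] c0 by simp
  obtain \<rho> where \<rho>: "0 < \<rho>" "g holomorphic_on cball 0 \<rho>"
      "\<forall>w\<in>cball 0 \<rho>. cross 0 w = g w * (w - 0) ^ nat (zorder (cross 0) 0) \<and> g w \<noteq> 0"
    using zorder_exist_zero[OF cross_holomorphic open_ball connected_ball 0 nc] unfolding g_def by blast
  have ev: "eventually (\<lambda>z. cross 0 z \<noteq> 0) (at 0)"
  proof -
    have "eventually (\<lambda>z. z \<in> ball 0 \<rho> - {0}) (at (0 :: complex))"
      using \<rho>(1) by (intro eventually_at_in_open) auto
    thus ?thesis by eventually_elim (use \<rho>(3) in auto)
  qed
  have e: "int e = zorder (cross 0) 0"
    unfolding e_def by (rule ram_index_eq_zorder_cross[OF 0 0 c0 ev])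
  hence e_pos: "e > 0" using pos by simp
  have ge: "cross 0 w = w ^ e * g w" "g w \<noteq> 0" if "w \<in> cball 0 \<rho>" for w
    using bspec[OF \<rho>(3) that] by (simp_all flip: e)
  define k where "k z = (if z = 0 then g 0 else cross 0 z / z ^ e)" for z
  have k_g: "k z = g z" if "z \<in> cball 0 \<rho>" for z
    using ge[OF that] by (simp add: k_def)
  have "k holomorphic_on ball 0 \<rho> \<longleftrightarrow> g holomorphic_on ball 0 \<rho>"
    by (rule holomorphic_cong) (auto simp: k_g)
  hence "k holomorphic_on ball 0 \<rho>"
    using \<rho>(2) by (auto elim: holomorphic_on_subset)
  moreover have "k holomorphic_on (ball 0 R - {0})"
  proof -
    have "(\<lambda>z. cross 0 z / z ^ e) holomorphic_on (ball 0 R - {0})"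
      using holomorphic_on_subset[OF cross_holomorphic[of 0] Diff_subset]
      by (intro holomorphic_intros) auto
    thus ?thesis by (rule holomorphic_transform) (auto simp: k_def)
  qed
  ultimately have "k holomorphic_on (ball 0 \<rho> \<union> (ball 0 R - {0}))"
    by (intro holomorphic_on_Un) auto
  hence k: "k holomorphic_on ball 0 R"
    by (rule holomorphic_on_subset) (use \<rho>(1) in auto)
  have k0: "k 0 \<noteq> 0" using ge(2)[of 0] \<rho>(1) by (simp add: k_def)
  have fac: "cross 0 z = z ^ e * k z" for z
    using e_pos c0 by (simp add: k_def)
  define S where "S = ball 0 R \<inter> q -` (- {0})"
  have S: "open S" "0 \<in> S"
    unfolding S_def using continuous_on_q 0 q0 by (auto intro!: continuous_open_preimage)
  define m where "m z = k z / (q 0 * q z)" for z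
  have "m holomorphic_on S"
    unfolding m_def [abs_def] using k holo_q q0
    by (auto intro!: holomorphic_intros elim: holomorphic_on_subset simp: S_def)
  hence "m analytic_on {0}" using S analytic_at by blast
  hence M: "m has_fps_expansion fps_expansion m 0"
    by (rule analytic_at_imp_has_fps_expansion_0)
  have "eventually (\<lambda>z. \<alpha> z = \<alpha> 0 + z ^ e * m z) (nhds 0)"
    using eventually_nhds_in_open[OF S]
  proof eventually_elim
    case (elim z)
    hence z: "z \<in> ball 0 R" "q z \<noteq> 0" by (auto simp: S_def)
    have "\<alpha> z - \<alpha> 0 = cross 0 z / (q 0 * q z)"
      using z q0 0 by (simp add: quotient cross_def field_simps)
    thus ?case by (simp add: fac m_def algebra_simps)
  qed
  moreover have "(\<lambda>z. \<alpha> 0 + z ^ e * m z) has_fps_expansion (fps_const (\<alpha> 0) + fps_X ^ e * fps_expansion m 0)"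
    by (intro fps_expansion_intros M)
  ultimately have "\<alpha> has_fps_expansion (fps_const (\<alpha> 0) + fps_X ^ e * fps_expansion m 0)"
    by (subst has_fps_expansion_cong) auto
  from fps_nth_fps_expansion[OF this, of e]
  have "(deriv ^^ e) \<alpha> 0 / fact e = m 0"
    using e_pos by (simp add: fps_X_power_mult_nth fps_expansion_def)
  hence "norm (k 0) = (norm (q 0))\<^sup>2 * norm ((deriv ^^ e) \<alpha> 0 / fact e)"
    using q0 by (simp add: m_def norm_divide norm_mult power2_eq_square)
  with k k0 fac show ?thesis using that by blast
qed

text \<open>
  Jensen's inequality for the cofactor \<open>k\<close> of $z^e$ in \<open>cross 0\<close> bounds the first sum of the
  overflow by the mean of \<open>ln (norm (cross 0 w))\<close> minus $e\log r$ and minus $\log|k(0)|$. Integrating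
  \<open>green_push_le\<close> over the circle bounds the second term by twice the mean of \<open>pot\<close> minus the same
  mean of \<open>ln (norm (cross 0 w))\<close>, so this quantity cancels. What remains is twice the mean of
  \<open>pot\<close>, that is $2\,T_\alpha(r)$ plus twice the value \<open>pot 0\<close>, together with explicit constants.
\<close>

lemma overflow_le:
  assumes r: "0 < r" "r < R" and q0: "q 0 \<noteq> 0" and nc: "\<exists>z\<in>ball 0 R. cross 0 z \<noteq> 0"
  defines "e \<equiv> ram_index \<alpha> 0"
  shows "enn2ereal (overflow \<alpha> r)
    \<le> ereal (2 * char_fun \<alpha> r - real e * ln r
        - ln (norm ((deriv ^^ e) \<alpha> 0 / fact e) / (1 + (norm (\<alpha> 0))\<^sup>2)))"
proof -
  have R: "0 < R" using r by simp
  have 0: "0 \<in> ball 0 R" using R by simp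
  obtain k where k: "k holomorphic_on ball 0 R" "k 0 \<noteq> 0"
      "\<And>z. z \<in> ball 0 R \<Longrightarrow> cross 0 z = z ^ e * k z"
      "norm (k 0) = (norm (q 0))\<^sup>2 * norm ((deriv ^^ e) \<alpha> 0 / fact e)"
    using cross_0_factor[OF nc R q0] unfolding e_def by metis
  have in_ball: "of_real r * cis t \<in> ball 0 R" for t using r by (simp add: norm_mult)
  define M where "M = (LINT t|angle_measure. pot (of_real r * cis t))"
  define s where "s = (\<Sum>a\<in>{a \<in> ball 0 r. k a = 0}. real_of_int (zorder k a) * ln (r / norm a))"
  \<comment> \<open>The bound of \<open>green_push_le\<close>; below, \<open>b'\<close> agrees with it almost everywhere and is written
    with \<open>k\<close>, which makes its integrability evident.\<close>
  define b where "b t = pot (of_real r * cis t) + M - ln (norm (cross 0 (of_real r * cis t)))" for t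
  note jensen = jensen_inequality[OF k(1,2) r]

  have fin: "finite {x \<in> cball 0 r. k x = 0}"
    using k r by (intro finite_zeros_in_ball) auto
  have ram: "int (ram_index \<alpha> x) = zorder k x" if x: "x \<in> cball 0 r" "k x = 0" for x
  proof -
    have x': "x \<in> ball 0 R" using x r by auto
    have "x \<noteq> 0" using x k by auto
    have evk: "eventually (\<lambda>z. k z \<noteq> 0) (at x)"
      using holomorphic_eventually_nonzero[OF k(1,2) x'] .
    have "eventually (\<lambda>z. z \<in> ball 0 R - {0}) (nhds x)"
      using x' \<open>x \<noteq> 0\<close> by (intro eventually_nhds_in_open) auto
    hence "eventually (\<lambda>z. z \<in> ball 0 R - {0}) (at x)"
      by (rule filter_leD[OF at_within_le_nhds])
    with evk have "eventually (\<lambda>z. cross 0 z \<noteq> 0) (at x)"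
      by eventually_elim (use k(3) in auto)
    hence "int (ram_index \<alpha> x) = zorder (cross 0) x"
      using k(3)[OF x'] x by (intro ram_index_eq_zorder_cross[OF 0 x']) auto
    also have "\<dots> = zorder k x"
    proof (rule zorder_unit_mult)
      show "open (ball 0 R)" "x \<in> ball 0 R" using x' by auto
      show "(\<lambda>z. z ^ e) holomorphic_on ball 0 R" "k holomorphic_on ball 0 R"
        using k(1) by (auto intro!: holomorphic_intros)
    qed (use k(3) \<open>x \<noteq> 0\<close> evk in auto)
    finally show ?thesis .
  qed
  have set_eq: "{x \<in> cball 0 r. sphere_map \<alpha> x = sphere_map \<alpha> 0 \<and> x \<noteq> 0} = {x \<in> cball 0 r. k x = 0}"
  proof (rule Collect_cong, rule conj_cong[OF refl])
    fix x assume "x \<in> cball (0 :: complex) r"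
    hence "x \<in> ball 0 R" using r by auto
    thus "sphere_map \<alpha> x = sphere_map \<alpha> 0 \<and> x \<noteq> 0 \<longleftrightarrow> k x = 0"
      using sphere_map_eq_iff_cross[OF 0, of x] k(2) k(3)[of x] by auto
  qed
  have first: "(\<Sum>x\<in>{x \<in> cball 0 r. sphere_map \<alpha> x = sphere_map \<alpha> 0 \<and> x \<noteq> 0}.
        of_nat (ram_index \<alpha> x) * green r x) = ennreal s"
    unfolding s_def by (rule sum_green_eq[OF k(1,2) r set_eq]) (use set_eq ram in blast)
  have s_nonneg: "0 \<le> s"
    unfolding s_def
  proof (rule sum_nonneg)
    fix a assume a: "a \<in> {a \<in> ball 0 r. k a = 0}"
    hence "a \<noteq> 0" using k by auto
    moreover have "0 \<le> zorder k a" using ram[of a, symmetric] a by simp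
    ultimately show "0 \<le> real_of_int (zorder k a) * ln (r / norm a)" using a by simp
  qed

  have nz: "AE t in angle_measure. k (of_real r * cis t) \<noteq> 0"
    using AE_angle_finite[OF fin r(1)] by eventually_elim (use r in \<open>auto simp: norm_mult\<close>)
  have cross_nz: "cross 0 (of_real r * cis t) \<noteq> 0" "ln (norm (cross 0 (of_real r * cis t)))
      = real e * ln r + ln (norm (k (of_real r * cis t)))" if "k (of_real r * cis t) \<noteq> 0" for t
    using that k(3)[OF in_ball, of t] r
    by (auto simp: norm_mult norm_power ln_mult ln_realpow)
  define b' where "b' t = pot (of_real r * cis t) + M - (real e * ln r + ln (norm (k (of_real r * cis t))))" for t
  have b_eq: "AE t in angle_measure. b t = b' t"
    using nz by eventually_elim (simp add: b_def b'_def cross_nz)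
  have pot_int: "integrable angle_measure (\<lambda>t. pot (of_real r * cis t))"
    using r by (intro integrable_angle_continuous continuous_on_circle[OF continuous_on_pot]) auto
  have b'_int: "integrable angle_measure b'"
    unfolding b'_def [abs_def] using pot_int jensen(1) by (intro Bochner_Integration.integrable_add Bochner_Integration.integrable_diff) auto
  have b'_mean: "(LINT t|angle_measure. b' t) = 2 * M - real e * ln r - (LINT t|angle_measure. ln (norm (k (of_real r * cis t))))"
    unfolding b'_def using pot_int jensen(1) by (simp add: angle.prob_space M_def)
  have b'_nonneg: "AE t in angle_measure. 0 \<le> b' t"
    using nz b_eq
  proof eventually_elim
    case (elim t)
    thus ?case using green_push_le(1)[OF r in_ball cross_nz(1)[OF elim(1)]] by (simp add: b_def M_def)
  qed
  have "(\<integral>\<^sup>+y. green_push \<alpha> r y \<partial>distr (circle_measure r) P1_borel (sphere_map \<alpha>))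
      \<le> (\<integral>\<^sup>+t. green_push \<alpha> r (sphere_map \<alpha> (of_real r * cis t)) \<partial>angle_measure)"
    by (rule nn_integral_circle_image_le[OF r])
  also have "\<dots> \<le> (\<integral>\<^sup>+t. ennreal (b' t) \<partial>angle_measure)"
  proof (rule nn_integral_mono_AE)
    show "AE t in angle_measure. green_push \<alpha> r (sphere_map \<alpha> (of_real r * cis t)) \<le> ennreal (b' t)"
      using nz b_eq
    proof eventually_elim
      case (elim t)
      thus ?case using green_push_le(2)[OF r in_ball cross_nz(1)[OF elim(1)]] by (simp add: b_def M_def)
    qed
  qed
  also have "\<dots> = ennreal (LINT t|angle_measure. b' t)"
    by (rule nn_integral_eq_integral[OF b'_int b'_nonneg])
  finally have "overflow \<alpha> r \<le> ennreal s + ennreal (LINT t|angle_measure. b' t)"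
    unfolding overflow_def first by (rule add_left_mono)
  also have "\<dots> = ennreal (s + (LINT t|angle_measure. b' t))"
    using s_nonneg b'_nonneg by (intro ennreal_plus [symmetric] integral_nonneg_AE) auto
  finally have "enn2ereal (overflow \<alpha> r) \<le> enn2ereal (ennreal (s + (LINT t|angle_measure. b' t)))"
    by (simp add: less_eq_ennreal.rep_eq)
  also have "\<dots> = ereal (s + (LINT t|angle_measure. b' t))"
    using s_nonneg b'_nonneg by (intro enn2ereal_ennreal add_nonneg_nonneg integral_nonneg_AE) auto
  also have "s + (LINT t|angle_measure. b' t) \<le> 2 * M - real e * ln r - ln (norm (k 0))"
    using jensen(2) by (simp add: b'_mean s_def)
  also have "2 * M - real e * ln r - ln (norm (k 0))
     = 2 * char_fun \<alpha> r - real e * ln r - ln (norm ((deriv ^^ e) \<alpha> 0 / fact e) / (1 + (norm (\<alpha> 0))\<^sup>2))"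
  proof -
    define d where "d = norm ((deriv ^^ e) \<alpha> 0 / fact e)"
    have d: "d > 0" using k(2) k(4) by (auto simp: d_def simp del: norm_divide)
    have "sqnorm 0 = (norm (q 0))\<^sup>2 * (1 + (norm (\<alpha> 0))\<^sup>2)"
      using q0 0 by (simp add: sqnorm_def quotient norm_divide power_divide field_simps)
    moreover have "1 + (norm (\<alpha> 0))\<^sup>2 > 0" by (simp add: add_pos_nonneg)
    ultimately have "2 * pot 0 = ln ((norm (q 0))\<^sup>2) + ln (1 + (norm (\<alpha> 0))\<^sup>2)"
      using q0 by (simp add: pot_def ln_mult)
    moreover have "ln (norm (k 0)) = ln ((norm (q 0))\<^sup>2) + ln d"
      unfolding k(4) d_def[symmetric] using q0 d by (simp add: ln_mult)
    moreover have "ln (d / (1 + (norm (\<alpha> 0))\<^sup>2)) = ln d - ln (1 + (norm (\<alpha> 0))\<^sup>2)"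
      using d \<open>1 + (norm (\<alpha> 0))\<^sup>2 > 0\<close> by (simp add: ln_div)
    ultimately show ?thesis
      unfolding char_fun_eq[OF r] d_def[symmetric] M_def by simp
  qed
  finally show ?thesis by simp
qed

end

theorem proposition5p4p5:
  fixes R :: ereal and \<alpha> :: "complex \<Rightarrow> complex" and e :: nat and r :: real
  assumes "0 < R"
    and "\<alpha> nicely_meromorphic_on eball 0 R"
    and "\<not> \<alpha> constant_on eball 0 R"
    and "sphere_map \<alpha> 0 \<noteq> None"
    and "e = ram_index \<alpha> 0"
    and "0 < r" and "ereal r < R"
  shows "enn2ereal (overflow \<alpha> r)
    \<le> ereal (2 * char_fun \<alpha> r - real e * ln r
        - ln (norm ((deriv ^^ e) \<alpha> 0 / fact e) / (1 + (norm (\<alpha> 0))\<^sup>2)))"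
proof -
  \<comment> \<open>Some room outside the closed disk of radius \<open>r\<close> is left for Jensen's inequality and Green's
    formula.\<close>
  obtain s where s: "r < s" "ereal s < R"
    using ereal_dense2[OF assms(7)] by auto
  have "0 < s" using s assms(6) by simp
  obtain p q where "meromorphic_quotient p q s \<alpha>"
    using meromorphic_quotient_exists[OF assms(2,3) \<open>0 < s\<close> s(2)] .
  then interpret meromorphic_quotient p q s \<alpha> .
  have 0: "0 \<in> ball 0 s" using \<open>0 < s\<close> by simp
  have q0: "q 0 \<noteq> 0"
    using assms(4) pole_iff[OF 0] by (auto simp: sphere_map_def)
  have "\<exists>z\<in>ball 0 s. cross 0 z \<noteq> 0"
  proof (rule ccontr)
    assume "\<not> ?thesis"
    hence eq: "sphere_map \<alpha> z = sphere_map \<alpha> 0" if "z \<in> ball 0 s" for z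
      using sphere_map_eq_iff_cross[OF 0 that] that by blast
    have "\<alpha> z = \<alpha> 0" if "z \<in> ball 0 s" for z
      using eq[OF that] assms(4) by (auto simp: sphere_map_def split: if_splits)
    hence "\<alpha> constant_on ball 0 s" by (auto simp: constant_on_def)
    moreover have "ball 0 s \<subseteq> eball 0 R"
      using s(2) by (intro ball_eball_mono) simp
    ultimately have "\<alpha> constant_on eball 0 R"
      using 0 by (intro constant_on_extend_nicely_meromorphic_on[OF assms(2)]) auto
    thus False using assms(3) by simp
  qed
  from overflow_le[OF assms(6) s(1) q0 this] show ?thesis
    unfolding assms(5) .
qed

end
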